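(* Let $p_{XYZ}$ be a joint distribution on finite sets $\mathcal X\times\mathcal Y\times\mathcal Z$ in normal form. Any secure sampling protocol $\Pi(p_{XYZ})$ satisfies \begin{align*} H(M_{23})&\ge RI(X;Z)+RI(X;Y)+H(Y,Z|X),\\ H(M_{31})&\ge RI(Y;Z)+RI(X;Y)+H(X,Z|Y),\\ H(M_{12})&\ge RI(X;Z)+RI(Y;Z)+H(X,Y|Z). \end{align*}
   Context: Secure sampling: three parties Alice (1), Bob (2), Charlie (3) receive no inputs; each has private randomness (no shared randomness), they exchange messages over multiple rounds on three pairwise private links (each message a codeword of a prefix-free code determined by previous messages on that link; termination with probability 1), and at the end Alice outputs $X$, Bob $Y$, Charlie $Z$. $M_{12},M_{23},M_{31}$ are the final transcripts on the Alice–Bob, Bob–Charlie, Charlie–Alice links. The protocol $\Pi(p_{XYZ})$ is a secure sampling protocol for $p_{XYZ}$ if $(X,Y,Z)\sim p_{XYZ}$ and the Markov chains $(M_{12},M_{31})-X-(Y,Z)$, $(M_{12},M_{23})-Y-(X,Z)$, $(M_{23},M_{31})-Z-(X,Y)$ hold. Normal form: $p_{XYZ}$ is in normal form if whenever $x,x'$ satisfy $p(x,y,z)=c\,p(x',y,z)$ for all $y,z$ for some constant $c\ge0$ then $x=x'$, and similarly for $y,y'$ and for $z,z'$. Residual information: $RI(U;V)=I(U;V)-H(U\sqcap V)$, where $U\sqcap V$ has maximum entropy among random variables of the form $f(U)=g(V)$ for deterministic $f,g$. *)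

theory Defs
  imports "HOL-Probability.Probability"
begin

definition pmf_ent :: "'a pmf \<Rightarrow> real" where
  "pmf_ent q = (\<Sum>a\<in>set_pmf q. - pmf q a * log 2 (pmf q a))"

definition mutual_inf :: "('u \<times> 'v) pmf \<Rightarrow> real" where
  "mutual_inf q = pmf_ent (map_pmf fst q) + pmf_ent (map_pmf snd q) - pmf_ent q"

text \<open>Entropy of the Gacs-Koerner common part: the maximum entropy of a random
  variable of the form f(U) = g(V) (almost surely).  Values are labelled by nat,
  which is no loss since U, V range over finite sets.\<close>
definition gk_common :: "('u \<times> 'v) pmf \<Rightarrow> real" where
  "gk_common q = (SUP fg \<in> {(f :: 'u \<Rightarrow> nat, g :: 'v \<Rightarrow> nat).
        \<forall>uv\<in>set_pmf q. f (fst uv) = g (snd uv)}.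
      pmf_ent (map_pmf (\<lambda>uv. fst fg (fst uv)) q))"

definition resid_info :: "('u \<times> 'v) pmf \<Rightarrow> real" where
  "resid_info q = mutual_inf q - gk_common q"

definition normal_form :: "('x \<times> 'y \<times> 'z) pmf \<Rightarrow> bool" where
  "normal_form p \<longleftrightarrow>
     (\<forall>x x'. (\<exists>c\<ge>0. \<forall>y z. pmf p (x,y,z) = c * pmf p (x',y,z)) \<longrightarrow> x = x') \<and>
     (\<forall>y y'. (\<exists>c\<ge>0. \<forall>x z. pmf p (x,y,z) = c * pmf p (x,y',z)) \<longrightarrow> y = y') \<and>
     (\<forall>z z'. (\<exists>c\<ge>0. \<forall>x y. pmf p (x,y,z) = c * pmf p (x,y,z')) \<longrightarrow> z = z')"

definition disc_ent :: "'w measure \<Rightarrow> ('w \<Rightarrow> 'a) \<Rightarrow> ennreal" where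
  "disc_ent M A = (\<integral>\<^sup>+ a. ennreal (- measure M {\<omega>\<in>space M. A \<omega> = a}
                         * log 2 (measure M {\<omega>\<in>space M. A \<omega> = a})) \<partial>count_space UNIV)"

definition markov_chain :: "'w measure \<Rightarrow> ('w \<Rightarrow> 'a) \<Rightarrow> ('w \<Rightarrow> 'b) \<Rightarrow> ('w \<Rightarrow> 'c) \<Rightarrow> bool" where
  "markov_chain M A B C \<longleftrightarrow> (\<forall>a b c.
     measure M {\<omega>\<in>space M. A \<omega> = a \<and> B \<omega> = b \<and> C \<omega> = c} * measure M {\<omega>\<in>space M. B \<omega> = b}
   = measure M {\<omega>\<in>space M. A \<omega> = a \<and> B \<omega> = b} * measure M {\<omega>\<in>space M. B \<omega> = b \<and> C \<omega> = c})"

datatype party = PA | PB | PC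

text \<open>Synchronous rounds.  In round t, party i sends to party j (i \<noteq> j) the message
  nm i j t (r i) v, where r i is its private randomness and v is the list of
  what it received in rounds 0..t-1 (as a function sender \<Rightarrow> message);
  None means no message.  hist nm r t is the list of all round records
  (sender \<Rightarrow> receiver \<Rightarrow> message) of rounds 0..t-1.\<close>
fun hist :: "(party \<Rightarrow> party \<Rightarrow> nat \<Rightarrow> 'r \<Rightarrow> (party \<Rightarrow> 'm option) list \<Rightarrow> 'm option)
             \<Rightarrow> (party \<Rightarrow> 'r) \<Rightarrow> nat \<Rightarrow> (party \<Rightarrow> party \<Rightarrow> 'm option) list" where
  "hist nm r 0 = []"
| "hist nm r (Suc t) = hist nm r t @
     [(\<lambda>i j. if i = j then None
             else nm i j t (r i) (map (\<lambda>rd k. rd k i) (hist nm r t)))]"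

definition msg :: "(party \<Rightarrow> party \<Rightarrow> nat \<Rightarrow> 'r \<Rightarrow> (party \<Rightarrow> 'm option) list \<Rightarrow> 'm option)
             \<Rightarrow> (party \<Rightarrow> 'r) \<Rightarrow> nat \<Rightarrow> party \<Rightarrow> party \<Rightarrow> 'm option" where
  "msg nm r t i j = (hist nm r (Suc t) ! t) i j"

definition trunc :: "(nat \<Rightarrow> 'm option \<times> 'm option) \<Rightarrow> ('m option \<times> 'm option) list" where
  "trunc s = (if \<exists>N. \<forall>t\<ge>N. s t = (None, None)
              then map s [0..<(LEAST N. \<forall>t\<ge>N. s t = (None, None))] else [])"

definition link :: "(party \<Rightarrow> party \<Rightarrow> nat \<Rightarrow> 'r \<Rightarrow> (party \<Rightarrow> 'm option) list \<Rightarrow> 'm option)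
             \<Rightarrow> (party \<Rightarrow> 'r) \<Rightarrow> party \<Rightarrow> party \<Rightarrow> ('m option \<times> 'm option) list" where
  "link nm r i j = trunc (\<lambda>t. (msg nm r t i j, msg nm r t j i))"

definition M12 where "M12 R nm = (\<lambda>\<omega>. link nm (\<lambda>k. R k \<omega>) PA PB)"
definition M23 where "M23 R nm = (\<lambda>\<omega>. link nm (\<lambda>k. R k \<omega>) PB PC)"
definition M31 where "M31 R nm = (\<lambda>\<omega>. link nm (\<lambda>k. R k \<omega>) PC PA)"

definition outX where "outX R nm oA = (\<lambda>\<omega>. oA (R PA \<omega>) (M12 R nm \<omega>) (M31 R nm \<omega>))"
definition outY where "outY R nm oB = (\<lambda>\<omega>. oB (R PB \<omega>) (M12 R nm \<omega>) (M23 R nm \<omega>))"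
definition outZ where "outZ R nm oC = (\<lambda>\<omega>. oC (R PC \<omega>) (M23 R nm \<omega>) (M31 R nm \<omega>))"

definition protocol ::
  "'w measure \<Rightarrow> (party \<Rightarrow> 'r measure) \<Rightarrow> (party \<Rightarrow> 'w \<Rightarrow> 'r)
   \<Rightarrow> (party \<Rightarrow> party \<Rightarrow> nat \<Rightarrow> 'r \<Rightarrow> (party \<Rightarrow> 'm option) list \<Rightarrow> 'm option)
   \<Rightarrow> ('r \<Rightarrow> ('m option \<times> 'm option) list \<Rightarrow> ('m option \<times> 'm option) list \<Rightarrow> 'x)
   \<Rightarrow> ('r \<Rightarrow> ('m option \<times> 'm option) list \<Rightarrow> ('m option \<times> 'm option) list \<Rightarrow> 'y)
   \<Rightarrow> ('r \<Rightarrow> ('m option \<times> 'm option) list \<Rightarrow> ('m option \<times> 'm option) list \<Rightarrow> 'z) \<Rightarrow> bool" where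
  "protocol M S R nm oA oB oC \<longleftrightarrow>
     prob_space M \<and> prob_space.indep_vars M S R UNIV \<and>
     (\<forall>i j t v. (\<lambda>r. nm i j t r v) \<in> measurable (S i) (count_space UNIV)) \<and>
     (\<forall>a b. (\<lambda>r. oA r a b) \<in> measurable (S PA) (count_space UNIV)) \<and>
     (\<forall>a b. (\<lambda>r. oB r a b) \<in> measurable (S PB) (count_space UNIV)) \<and>
     (\<forall>a b. (\<lambda>r. oC r a b) \<in> measurable (S PC) (count_space UNIV)) \<and>
     (AE \<omega> in M. \<exists>N. \<forall>t\<ge>N. \<forall>i j. msg nm (\<lambda>k. R k \<omega>) t i j = None)"

definition secure_sampling ::
  "('x \<times> 'y \<times> 'z) pmf \<Rightarrow> 'w measure \<Rightarrow> (party \<Rightarrow> 'r measure) \<Rightarrow> (party \<Rightarrow> 'w \<Rightarrow> 'r)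
   \<Rightarrow> (party \<Rightarrow> party \<Rightarrow> nat \<Rightarrow> 'r \<Rightarrow> (party \<Rightarrow> 'm option) list \<Rightarrow> 'm option)
   \<Rightarrow> ('r \<Rightarrow> ('m option \<times> 'm option) list \<Rightarrow> ('m option \<times> 'm option) list \<Rightarrow> 'x)
   \<Rightarrow> ('r \<Rightarrow> ('m option \<times> 'm option) list \<Rightarrow> ('m option \<times> 'm option) list \<Rightarrow> 'y)
   \<Rightarrow> ('r \<Rightarrow> ('m option \<times> 'm option) list \<Rightarrow> ('m option \<times> 'm option) list \<Rightarrow> 'z) \<Rightarrow> bool" where
  "secure_sampling p M S R nm oA oB oC \<longleftrightarrow>
     protocol M S R nm oA oB oC \<and>
     (let X = outX R nm oA; Y = outY R nm oB; Z = outZ R nm oC;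
          m12 = M12 R nm; m23 = M23 R nm; m31 = M31 R nm in
       (\<forall>x y z. measure M {\<omega>\<in>space M. X \<omega> = x \<and> Y \<omega> = y \<and> Z \<omega> = z} = pmf p (x, y, z)) \<and>
       markov_chain M (\<lambda>\<omega>. (m12 \<omega>, m31 \<omega>)) X (\<lambda>\<omega>. (Y \<omega>, Z \<omega>)) \<and>
       markov_chain M (\<lambda>\<omega>. (m12 \<omega>, m23 \<omega>)) Y (\<lambda>\<omega>. (X \<omega>, Z \<omega>)) \<and>
       markov_chain M (\<lambda>\<omega>. (m23 \<omega>, m31 \<omega>)) Z (\<lambda>\<omega>. (X \<omega>, Y \<omega>)))"

end

theory Submission
  imports Defs
begin

text \<open>
  Write \<open>B\<close>, \<open>C\<close>, \<open>D\<close> for the transcripts on the links 12, 31, 23.  Conditionally on the links of a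
  party, its randomness is independent of that of the other two, so each message it sends is independent
  of the opposite link given its own links.  Hence \<open>H(D) + H(D|B,C) - H(D|B) - H(D|C)\<close> never decreases
  while messages are exchanged, i.e.
  \<open>H(D) \<ge> I(D;C|B) + I(D;B|C) + H(D|B,C)\<close>.  Normal form, privacy and the same independence force every
  output to be a function of the links of its party.  Data processing then bounds the three terms
  below by \<open>I(X;Y|B)\<close>, \<open>I(X;Z|C)\<close> and \<open>H(Y,Z|X)\<close>; since \<open>B - X - Y\<close> and \<open>B - Y - X\<close> are both Markov
  chains, \<open>B\<close> depends on the pair only through a common part of it, so \<open>I(X;Y|B) \<ge> RI(X;Y)\<close>.

  Only \<open>D\<close> may be assumed to have finite entropy, so \<open>H(\<cdot>|\<cdot>)\<close> is the expected difference of two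
  surprisals, which is finite as soon as its first argument has finite entropy.  Protocols need not stop
  within a bounded number of rounds: the inequality is proved for the first \<open>T\<close> rounds, which determine
  the outputs up to conditional entropies that vanish as \<open>T\<close> grows.
\<close>

subsection \<open>Conditional entropy of discrete random variables\<close>

text \<open>The private randomness may be uncountable, so all entropies are taken under
  \<open>q\<close>, the countable law of the three transcripts and the three outputs; the randomness
  survives only in product formulas for probabilities, one factor per party. The monotone quantity
  is the co-information I(B;C) - I(B;C|D). It is symmetric in B, C and D, but it is written through
  conditional entropies of D because B and C may have infinite entropy. In a synchronous round all
  parties speak at once, and a simultaneous change of all three links has no evident sign. Messages
  of one round depend on earlier rounds only, so a round can be serialized: the parties advance one
  at a time, each with its own clock. A single sender extends just its own two links. Since its new
  messages are independent of the opposite link given these two, the co-information grows, for each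
  of the two links, by the mutual information of its extension with the opposite link given its
  past.\<close>

definition pr :: "'w pmf \<Rightarrow> ('w \<Rightarrow> 'a) \<Rightarrow> 'w \<Rightarrow> real" where
  "pr q A w = measure_pmf.prob q {v. A v = A w}"

text \<open>A function of the outcome rather than of the value, so that entropy identities hold
  pointwise and terms of infinite expectation cancel before integration.\<close>

definition surprisal :: "'w pmf \<Rightarrow> ('w \<Rightarrow> 'a) \<Rightarrow> 'w \<Rightarrow> real" where
  "surprisal q A w = - log 2 (pr q A w)"

text \<open>A non-integrable difference would integrate to 0, so the rules that add or compare two
  conditional entropies with different integrands ask for \<open>fin_ent\<close> of the first
  argument.\<close>

definition cond_ent :: "'w pmf \<Rightarrow> ('w \<Rightarrow> 'a) \<Rightarrow> ('w \<Rightarrow> 'b) \<Rightarrow> real" where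
  "cond_ent q A B = (\<integral>w. surprisal q (\<lambda>w. (A w, B w)) w - surprisal q B w \<partial>measure_pmf q)"

abbreviation ent :: "'w pmf \<Rightarrow> ('w \<Rightarrow> 'a) \<Rightarrow> real" where
  "ent q A \<equiv> cond_ent q A (\<lambda>_. ())"

definition fin_ent :: "'w pmf \<Rightarrow> ('w \<Rightarrow> 'a) \<Rightarrow> bool" where
  "fin_ent q A \<longleftrightarrow> integrable (measure_pmf q) (surprisal q A)"

text \<open>Restricted to the support because outputs are functions of the links, and links
  functions of the messages, only almost surely.\<close>

definition determines :: "'w pmf \<Rightarrow> ('w \<Rightarrow> 'a) \<Rightarrow> ('w \<Rightarrow> 'b) \<Rightarrow> bool" where
  "determines q A B \<longleftrightarrow> (\<forall>v\<in>set_pmf q. \<forall>w\<in>set_pmf q. A v = A w \<longrightarrow> B v = B w)"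

definition cond_indep :: "'w pmf \<Rightarrow> ('w \<Rightarrow> 'a) \<Rightarrow> ('w \<Rightarrow> 'b) \<Rightarrow> ('w \<Rightarrow> 'c) \<Rightarrow> bool" where
  "cond_indep q A B C \<longleftrightarrow> (\<forall>a b c.
     measure_pmf.prob q {w. A w = a \<and> B w = b \<and> C w = c} * measure_pmf.prob q {w. B w = b}
   = measure_pmf.prob q {w. A w = a \<and> B w = b} * measure_pmf.prob q {w. B w = b \<and> C w = c})"

lemma determinesI:
  "(\<And>v w. v \<in> set_pmf q \<Longrightarrow> w \<in> set_pmf q \<Longrightarrow> A v = A w \<Longrightarrow> B v = B w) \<Longrightarrow> determines q A B"
  unfolding determines_def by blast

lemma determinesD:
  "determines q A B \<Longrightarrow> v \<in> set_pmf q \<Longrightarrow> w \<in> set_pmf q \<Longrightarrow> A v = A w \<Longrightarrow> B v = B w"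
  unfolding determines_def by blast

lemma prob_cong_supp:
  assumes "\<And>w. w \<in> set_pmf q \<Longrightarrow> P w \<longleftrightarrow> Q w"
  shows "measure_pmf.prob q {w. P w} = measure_pmf.prob q {w. Q w}"
  by (rule measure_pmf.finite_measure_eq_AE) (auto simp: AE_measure_pmf_iff assms)

lemma prob_mono_supp:
  assumes "\<And>w. w \<in> set_pmf q \<Longrightarrow> P w \<Longrightarrow> Q w"
  shows "measure_pmf.prob q {w. P w} \<le> measure_pmf.prob q {w. Q w}"
  by (rule measure_pmf.finite_measure_mono_AE) (auto simp: AE_measure_pmf_iff assms)

lemma pr_pos: "w \<in> set_pmf q \<Longrightarrow> pr q A w > 0"
  unfolding pr_def by (rule measure_pmf_posI) auto

lemma pr_le_1: "pr q A w \<le> 1"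
  unfolding pr_def by simp

lemma pr_mono:
  assumes "determines q A B" "w \<in> set_pmf q"
  shows "pr q A w \<le> pr q B w"
  unfolding pr_def using assms(2) by (intro prob_mono_supp determinesD[OF assms(1)]) auto

lemma surprisal_nonneg: "w \<in> set_pmf q \<Longrightarrow> surprisal q A w \<ge> 0"
  unfolding surprisal_def using pr_pos[of w q A] pr_le_1[of q A w] by simp

lemma surprisal_mono:
  assumes "determines q A B" "w \<in> set_pmf q"
  shows "surprisal q B w \<le> surprisal q A w"
  unfolding surprisal_def using pr_mono[OF assms] pr_pos[OF assms(2), of A] by simp

lemma surprisal_cong:
  assumes "determines q A B" "determines q B A" "w \<in> set_pmf q"
  shows "surprisal q A w = surprisal q B w"
  using surprisal_mono[OF assms(1,3)] surprisal_mono[OF assms(2,3)] by simp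

lemma surprisal_const: "surprisal q (\<lambda>_. c) w = 0"
  by (simp add: surprisal_def pr_def)

text \<open>The weight p(a,b,c) cancels the denominator, which leaves the sum of p(a,b) p(c,b) /
  p(b) over the support. Over all triples this sum is 1, since each b contributes p(b); the omitted
  triples cause the inequality.\<close>

lemma nn_integral_pr_ratio:
  "(\<integral>\<^sup>+w. ennreal (pr q (\<lambda>w. (A w, B w)) w * pr q (\<lambda>w. (C w, B w)) w
       / (pr q B w * pr q (\<lambda>w. (A w, C w, B w)) w)) \<partial>measure_pmf q) \<le> 1"
proof -
  define PA where "PA a b = pmf (map_pmf (\<lambda>w. (A w, B w)) q) (a, b)" for a b
  define PC where "PC c b = pmf (map_pmf (\<lambda>w. (C w, B w)) q) (c, b)" for c b
  define PB where "PB b = pmf (map_pmf B q) b" for b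
  let ?J = "map_pmf (\<lambda>w. (B w, A w, C w)) q"
  define G where "G = (\<lambda>(b, a, c). ennreal (PA a b * PC c b / (PB b * pmf ?J (b, a, c))))"
  have marg: "(\<integral>\<^sup>+a. ennreal (pmf (map_pmf (\<lambda>w. (A' w, B w)) q) (a, b)) \<partial>count_space UNIV) = ennreal (PB b)"
    for A' :: "_ \<Rightarrow> 'z" and b
  proof -
    have "(\<integral>\<^sup>+a. ennreal (pmf (map_pmf (\<lambda>w. (A' w, B w)) q) (a, b)) \<partial>count_space UNIV)
        = (\<integral>\<^sup>+x. ennreal (pmf (map_pmf (\<lambda>w. (A' w, B w)) q) x) \<partial>count_space ((\<lambda>a. (a, b)) ` UNIV))"
      by (rule nn_integral_bij_count_space) (auto simp: bij_betw_def inj_on_def)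
    also have "\<dots> = emeasure (map_pmf (\<lambda>w. (A' w, B w)) q) ((\<lambda>a. (a, b)) ` UNIV)"
      by (rule nn_integral_pmf)
    also have "\<dots> = emeasure q {w. B w = b}"
      by (auto simp: measure_pmf.emeasure_eq_measure vimage_def intro!: arg_cong2[where f=measure])
    also have "\<dots> = ennreal (PB b)"
      by (auto simp: PB_def pmf_map vimage_def measure_pmf.emeasure_eq_measure)
    finally show ?thesis .
  qed
  have "(\<integral>\<^sup>+w. ennreal (pr q (\<lambda>w. (A w, B w)) w * pr q (\<lambda>w. (C w, B w)) w
       / (pr q B w * pr q (\<lambda>w. (A w, C w, B w)) w)) \<partial>measure_pmf q)
     = (\<integral>\<^sup>+x. G x \<partial>measure_pmf ?J)"
    by (auto simp: G_def PA_def PC_def PB_def pr_def pmf_map vimage_def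
        intro!: nn_integral_cong arg_cong[where f=ennreal] arg_cong2[where f="(/)"] arg_cong2[where f="(*)"]
          arg_cong2[where f=measure])
  also have "\<dots> = (\<integral>\<^sup>+x. ennreal (pmf ?J x) * G x \<partial>count_space UNIV)"
    by (rule nn_integral_measure_pmf)
  also have "\<dots> \<le> (\<integral>\<^sup>+x. (case x of (b, a, c) \<Rightarrow> ennreal (PA a b) * (ennreal (PC c b) * ennreal (inverse (PB b)))) \<partial>count_space UNIV)"
  proof (rule nn_integral_mono)
    fix x :: "'c \<times> 'b \<times> 'd"
    obtain b a c where x: "x = (b, a, c)" by (cases x) auto
    show "ennreal (pmf ?J x) * G x \<le> (case x of (b, a, c) \<Rightarrow> ennreal (PA a b) * (ennreal (PC c b) * ennreal (inverse (PB b))))"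
      by (cases "pmf ?J x = 0")
        (auto simp: x G_def PA_def PC_def PB_def ennreal_mult[symmetric] field_simps intro!: ennreal_leI)
  qed
  also have "\<dots> = (\<integral>\<^sup>+b. \<integral>\<^sup>+a. \<integral>\<^sup>+c. ennreal (PA a b) * (ennreal (PC c b) * ennreal (inverse (PB b)))
      \<partial>count_space UNIV \<partial>count_space UNIV \<partial>count_space UNIV)"
    by (simp add: nn_integral_fst_count_space[symmetric])
  also have "\<dots> = (\<integral>\<^sup>+b. ennreal (PB b) * (ennreal (PB b) * ennreal (inverse (PB b))) \<partial>count_space UNIV)"
    by (simp add: nn_integral_cmult nn_integral_multc marg[of A, folded PA_def] marg[of C, folded PC_def])
  also have "\<dots> \<le> (\<integral>\<^sup>+b. ennreal (pmf (map_pmf B q) b) \<partial>count_space UNIV)"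
    by (rule nn_integral_mono) (auto simp: PB_def ennreal_mult[symmetric] field_simps intro!: ennreal_leI)
  also have "\<dots> = 1"
    by (simp add: nn_integral_pmf)
  finally show ?thesis .
qed

lemma pr_ratio_integrable:
  fixes q :: "'w pmf" and A :: "'w \<Rightarrow> 'a" and B :: "'w \<Rightarrow> 'b" and C :: "'w \<Rightarrow> 'c"
  defines "u \<equiv> \<lambda>w. pr q (\<lambda>w. (A w, B w)) w * pr q (\<lambda>w. (C w, B w)) w
       / (pr q B w * pr q (\<lambda>w. (A w, C w, B w)) w)"
  shows "integrable (measure_pmf q) u" "(\<integral>w. u w \<partial>measure_pmf q) \<le> 1"
proof -
  have nn: "u w \<ge> 0" for w
    by (simp add: u_def pr_def)
  have le: "(\<integral>\<^sup>+w. ennreal (u w) \<partial>measure_pmf q) \<le> 1"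
    unfolding u_def by (rule nn_integral_pr_ratio)
  show i: "integrable (measure_pmf q) u"
    by (rule integrableI_nonneg) (use nn le order_le_less_trans[OF le] in auto)
  have "ennreal (\<integral>w. u w \<partial>measure_pmf q) \<le> 1"
    using nn_integral_eq_integral[OF i] nn le by simp
  then show "(\<integral>w. u w \<partial>measure_pmf q) \<le> 1"
    by simp
qed

text \<open>This is \<open>ln u \<le> u - 1\<close>. The pointwise form serves twice: integrated, it
  yields nonnegativity of conditional mutual information, and as a majorant it yields integrability
  of conditional surprisals.\<close>

lemma surprisal_ratio_le:
  assumes "w \<in> set_pmf q"
  shows "surprisal q B w + surprisal q (\<lambda>w. (A w, C w, B w)) w
       - surprisal q (\<lambda>w. (A w, B w)) w - surprisal q (\<lambda>w. (C w, B w)) w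
     \<le> (pr q (\<lambda>w. (A w, B w)) w * pr q (\<lambda>w. (C w, B w)) w
       / (pr q B w * pr q (\<lambda>w. (A w, C w, B w)) w) - 1) / ln 2" (is "?l \<le> (?u - 1) / ln 2")
proof -
  have p: "pr q (\<lambda>w. (A w, B w)) w > 0" "pr q (\<lambda>w. (C w, B w)) w > 0" "pr q B w > 0"
     "pr q (\<lambda>w. (A w, C w, B w)) w > 0"
    using assms by (auto intro: pr_pos)
  have "?l = ln ?u / ln 2"
    using p by (simp add: surprisal_def log_def ln_div ln_mult add_divide_distrib diff_divide_distrib)
  moreover have "ln ?u \<le> ?u - 1"
    using p by (intro ln_le_minus_one) simp
  ultimately show ?thesis
    by (simp add: divide_right_mono)
qed

text \<open>Only the combined integrand is assumed integrable; each of its four surprisals may have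
  infinite expectation.\<close>

lemma cond_mutual_info_nonneg:
  fixes q :: "'w pmf" and A :: "'w \<Rightarrow> 'a" and B :: "'w \<Rightarrow> 'b" and C :: "'w \<Rightarrow> 'c"
  defines "W \<equiv> \<lambda>w. surprisal q (\<lambda>w. (A w, B w)) w + surprisal q (\<lambda>w. (C w, B w)) w
       - surprisal q B w - surprisal q (\<lambda>w. (A w, C w, B w)) w"
  assumes "integrable (measure_pmf q) W"
  shows "0 \<le> (\<integral>w. W w \<partial>measure_pmf q)"
proof -
  let ?u = "\<lambda>w. pr q (\<lambda>w. (A w, B w)) w * pr q (\<lambda>w. (C w, B w)) w
       / (pr q B w * pr q (\<lambda>w. (A w, C w, B w)) w)"
  note u = pr_ratio_integrable[of q A B C]
  have "(\<integral>w. - W w \<partial>measure_pmf q) \<le> (\<integral>w. (?u w - 1) / ln 2 \<partial>measure_pmf q)"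
  proof (rule integral_mono_AE)
    show "integrable (measure_pmf q) (\<lambda>w. - W w)"
      using assms(2) by (rule Bochner_Integration.integrable_minus)
    show "integrable (measure_pmf q) (\<lambda>w. (?u w - 1) / ln 2)"
      using u(1) by (intro integrable_divide_zero Bochner_Integration.integrable_diff) auto
    show "AE w in measure_pmf q. - W w \<le> (?u w - 1) / ln 2"
      unfolding AE_measure_pmf_iff
    proof
      fix w assume "w \<in> set_pmf q"
      from surprisal_ratio_le[OF this, of B A C] show "- W w \<le> (?u w - 1) / ln 2" unfolding W_def by linarith
    qed
  qed
  also have "\<dots> = ((\<integral>w. ?u w \<partial>measure_pmf q) - 1) / ln 2"
    using u(1) by simp
  also have "\<dots> \<le> 0"
    using u(2) by (simp add: divide_nonpos_pos)
  finally show ?thesis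
    using assms(2) by simp
qed

lemma cond_surprisal_nonneg:
  "w \<in> set_pmf q \<Longrightarrow> surprisal q (\<lambda>w. (A w, B w)) w - surprisal q B w \<ge> 0"
  unfolding diff_ge_0_iff_ge by (rule surprisal_mono) (auto simp: determines_def)

text \<open>Pointwise, conditioning can increase a surprisal, so \<open>surprisal q A\<close> is no
  majorant. The excess is at most (u - 1) / ln 2, where u is the ratio for A and B under trivial
  conditioning, and u has mean at most 1.\<close>

lemma integrable_cond_surprisal:
  assumes "fin_ent q A"
  shows "integrable (measure_pmf q) (\<lambda>w. surprisal q (\<lambda>w. (A w, B w)) w - surprisal q B w)"
proof -
  let ?u = "\<lambda>w. pr q (\<lambda>w. (A w, ())) w * pr q (\<lambda>w. (B w, ())) w
       / (pr q (\<lambda>_. ()) w * pr q (\<lambda>w. (A w, B w, ())) w)"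
  show ?thesis
  proof (rule Bochner_Integration.integrable_bound[where f="\<lambda>w. surprisal q A w + (?u w - 1) / ln 2"])
    show "integrable (measure_pmf q) (\<lambda>w. surprisal q A w + (?u w - 1) / ln 2)"
      by (rule Bochner_Integration.integrable_add[OF assms[unfolded fin_ent_def]
            integrable_divide_zero[OF Bochner_Integration.integrable_diff[OF
              pr_ratio_integrable(1)[of q A "\<lambda>_. ()" B]]]]) simp
    show "AE w in measure_pmf q. norm (surprisal q (\<lambda>w. (A w, B w)) w - surprisal q B w)
        \<le> norm (surprisal q A w + (?u w - 1) / ln 2)"
      unfolding AE_measure_pmf_iff
    proof
      fix w assume w: "w \<in> set_pmf q"
      have e: "surprisal q (\<lambda>w. (A w, B w, ())) w = surprisal q (\<lambda>w. (A w, B w)) w"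
        "surprisal q (\<lambda>w. (A w, ())) w = surprisal q A w"
        "surprisal q (\<lambda>w. (B w, ())) w = surprisal q B w"
        using w by (auto intro!: surprisal_cong simp: determines_def)
      show "norm (surprisal q (\<lambda>w. (A w, B w)) w - surprisal q B w)
        \<le> norm (surprisal q A w + (?u w - 1) / ln 2)"
        using surprisal_ratio_le[OF w, of "\<lambda>_. ()" A B] cond_surprisal_nonneg[OF w, of A B]
        unfolding e surprisal_const by simp
    qed
  qed simp
qed

section \<open>Calculus of conditional entropy\<close>

lemma cond_ent_nonneg: "cond_ent q A B \<ge> 0"
  unfolding cond_ent_def
  by (rule integral_nonneg_AE) (rule AE_pmfI, rule cond_surprisal_nonneg)

lemma cond_ent_cong:
  assumes "determines q (\<lambda>w. (A w, B w)) (\<lambda>w. (A' w, B' w))"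
    "determines q (\<lambda>w. (A' w, B' w)) (\<lambda>w. (A w, B w))" "determines q B B'" "determines q B' B"
  shows "cond_ent q A B = cond_ent q A' B'"
  unfolding cond_ent_def
  by (intro integral_cong_AE AE_pmfI arg_cong2[where f="(-)"] surprisal_cong assms) simp_all

lemma cond_ent_determined:
  assumes "determines q B A"
  shows "cond_ent q A B = 0"
proof -
  have "cond_ent q A B = (\<integral>w. 0 \<partial>measure_pmf q)"
    unfolding cond_ent_def
  proof (rule integral_cong_AE)
    show "AE w in measure_pmf q. surprisal q (\<lambda>w. (A w, B w)) w - surprisal q B w = 0"
    proof (rule AE_pmfI)
      fix w assume "w \<in> set_pmf q"
      then have "surprisal q (\<lambda>w. (A w, B w)) w = surprisal q B w"
        by (intro surprisal_cong determinesI) (auto intro: determinesD[OF assms])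
      then show "surprisal q (\<lambda>w. (A w, B w)) w - surprisal q B w = 0" by simp
    qed
  qed simp_all
  then show ?thesis by simp
qed

lemma fin_ent_mono:
  assumes "fin_ent q A" "determines q A B"
  shows "fin_ent q B"
  unfolding fin_ent_def
  by (rule Bochner_Integration.integrable_bound[where f="surprisal q A"])
    (use assms in \<open>auto simp: fin_ent_def AE_measure_pmf_iff abs_of_nonneg surprisal_nonneg intro!: surprisal_mono\<close>)

lemma fin_ent_Pair:
  assumes "fin_ent q A" "fin_ent q B"
  shows "fin_ent q (\<lambda>w. (A w, B w))"
proof -
  have "integrable (measure_pmf q) (\<lambda>w. (surprisal q (\<lambda>w. (A w, B w)) w - surprisal q B w) + surprisal q B w)"
    using assms integrable_cond_surprisal[OF assms(1)]
    by (intro Bochner_Integration.integrable_add) (auto simp: fin_ent_def)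
  then show ?thesis by (simp add: fin_ent_def)
qed

lemma cond_ent_mono_left:
  assumes "fin_ent q A" "determines q (\<lambda>w. (A w, B w)) A'" "fin_ent q A'"
  shows "cond_ent q A' B \<le> cond_ent q A B"
  unfolding cond_ent_def
proof (rule integral_mono_AE)
  show "AE w in measure_pmf q. surprisal q (\<lambda>w. (A' w, B w)) w - surprisal q B w
      \<le> surprisal q (\<lambda>w. (A w, B w)) w - surprisal q B w"
    by (intro AE_pmfI diff_right_mono surprisal_mono determinesI) (auto intro: determinesD[OF assms(2)])
qed (intro integrable_cond_surprisal assms)+

lemma cond_ent_chain:
  assumes "fin_ent q A" "fin_ent q A'"
  shows "cond_ent q (\<lambda>w. (A w, A' w)) B = cond_ent q A B + cond_ent q A' (\<lambda>w. (A w, B w))"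
proof -
  have "cond_ent q (\<lambda>w. (A w, A' w)) B = (\<integral>w. (surprisal q (\<lambda>w. (A w, B w)) w - surprisal q B w) +
     (surprisal q (\<lambda>w. (A' w, A w, B w)) w - surprisal q (\<lambda>w. (A w, B w)) w) \<partial>measure_pmf q)"
    unfolding cond_ent_def
  proof (rule integral_cong_AE)
    show "AE w in measure_pmf q. surprisal q (\<lambda>w. ((A w, A' w), B w)) w - surprisal q B w
      = (surprisal q (\<lambda>w. (A w, B w)) w - surprisal q B w) +
        (surprisal q (\<lambda>w. (A' w, A w, B w)) w - surprisal q (\<lambda>w. (A w, B w)) w)"
    proof (rule AE_pmfI)
      fix w assume "w \<in> set_pmf q"
      then have "surprisal q (\<lambda>w. ((A w, A' w), B w)) w = surprisal q (\<lambda>w. (A' w, A w, B w)) w"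
        by (intro surprisal_cong) (auto simp: determines_def)
      then show "surprisal q (\<lambda>w. ((A w, A' w), B w)) w - surprisal q B w
      = (surprisal q (\<lambda>w. (A w, B w)) w - surprisal q B w) +
        (surprisal q (\<lambda>w. (A' w, A w, B w)) w - surprisal q (\<lambda>w. (A w, B w)) w)" by simp
    qed
  qed simp_all
  also have "\<dots> = cond_ent q A B + cond_ent q A' (\<lambda>w. (A w, B w))"
    unfolding cond_ent_def by (intro Bochner_Integration.integral_add integrable_cond_surprisal assms)
  finally show ?thesis .
qed

text \<open>The gap is I(A;C|B). As C determines B, its integrand collapses to a difference of two
  conditional surprisals of A, which is integrable even when B and C have infinite entropy.\<close>

lemma cond_ent_mono:
  assumes A: "fin_ent q A" and "determines q C B"
  shows "cond_ent q A C \<le> cond_ent q A B"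
proof -
  let ?f = "\<lambda>w. surprisal q (\<lambda>w. (A w, B w)) w - surprisal q B w"
  let ?g = "\<lambda>w. surprisal q (\<lambda>w. (A w, C w)) w - surprisal q C w"
  let ?W = "\<lambda>w. surprisal q (\<lambda>w. (A w, B w)) w + surprisal q (\<lambda>w. (C w, B w)) w
       - surprisal q B w - surprisal q (\<lambda>w. (A w, C w, B w)) w"
  note i = integrable_cond_surprisal[OF A, of B] integrable_cond_surprisal[OF A, of C]
  have eq: "AE w in measure_pmf q. ?W w = ?f w - ?g w"
    unfolding AE_measure_pmf_iff
  proof
    fix w assume w: "w \<in> set_pmf q"
    have "surprisal q (\<lambda>w. (C w, B w)) w = surprisal q C w"
      "surprisal q (\<lambda>w. (A w, C w, B w)) w = surprisal q (\<lambda>w. (A w, C w)) w"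
      using w by (auto intro!: surprisal_cong determinesI intro: determinesD[OF assms(2)])
    then show "?W w = ?f w - ?g w" by simp
  qed
  have "integrable (measure_pmf q) ?W"
    using Bochner_Integration.integrable_diff[OF i] by (rule integrable_cong_AE_imp) (use eq in auto)
  from cond_mutual_info_nonneg[OF this]
  have "0 \<le> (\<integral>w. ?f w - ?g w \<partial>measure_pmf q)"
    using integral_cong_AE[OF _ _ eq] by simp
  then show ?thesis
    unfolding cond_ent_def using Bochner_Integration.integral_diff[OF i] by simp
qed

section \<open>Conditional independence\<close>

lemma cond_indep_commute: "cond_indep q A B C \<Longrightarrow> cond_indep q C B A"
  unfolding cond_indep_def by (simp add: conj_ac mult.commute)

lemma cond_indep_surprisal:
  assumes "cond_indep q A B C" "w \<in> set_pmf q"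
  shows "surprisal q (\<lambda>w. (A w, C w, B w)) w + surprisal q B w
       = surprisal q (\<lambda>w. (A w, B w)) w + surprisal q (\<lambda>w. (C w, B w)) w"
proof -
  have p: "pr q (\<lambda>w. (A w, B w)) w > 0" "pr q (\<lambda>w. (C w, B w)) w > 0" "pr q B w > 0"
     "pr q (\<lambda>w. (A w, C w, B w)) w > 0"
    using assms by (auto intro: pr_pos)
  have "pr q (\<lambda>w. (A w, C w, B w)) w * pr q B w = pr q (\<lambda>w. (A w, B w)) w * pr q (\<lambda>w. (C w, B w)) w"
    using assms(1)[unfolded cond_indep_def, rule_format, of "A w" "B w" "C w"]
    by (simp add: pr_def conj_ac)
  then have "log 2 (pr q (\<lambda>w. (A w, C w, B w)) w * pr q B w) = log 2 (pr q (\<lambda>w. (A w, B w)) w * pr q (\<lambda>w. (C w, B w)) w)"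
    by simp
  then show ?thesis
    using p by (simp add: surprisal_def log_mult)
qed

lemma cond_ent_cond_indep:
  assumes "cond_indep q A B C"
  shows "cond_ent q A (\<lambda>w. (C w, B w)) = cond_ent q A B"
  unfolding cond_ent_def
proof (rule integral_cong_AE)
  show "AE w in measure_pmf q. surprisal q (\<lambda>w. (A w, C w, B w)) w - surprisal q (\<lambda>w. (C w, B w)) w =
       surprisal q (\<lambda>w. (A w, B w)) w - surprisal q B w"
  proof (rule AE_pmfI)
    fix w assume "w \<in> set_pmf q"
    from cond_indep_surprisal[OF assms this]
    show "surprisal q (\<lambda>w. (A w, C w, B w)) w - surprisal q (\<lambda>w. (C w, B w)) w =
       surprisal q (\<lambda>w. (A w, B w)) w - surprisal q B w" by linarith
  qed
qed simp_all

text \<open>Total probability over the values of A, whose type may be uncountable: a link is a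
  function on all rounds. Tonelli between two counting measures applies because \<open>q\<close> is
  discrete.\<close>

lemma emeasure_partition:
  "emeasure (measure_pmf q) {w. P w} = (\<integral>\<^sup>+a. emeasure (measure_pmf q) {w. P w \<and> A w = a} \<partial>count_space UNIV)"
proof -
  have "(\<integral>\<^sup>+a. emeasure (measure_pmf q) {w. P w \<and> A w = a} \<partial>count_space UNIV)
     = (\<integral>\<^sup>+a. \<integral>\<^sup>+w. indicator {w. P w \<and> A w = a} w \<partial>measure_pmf q \<partial>count_space UNIV)"
    by (simp only: nn_integral_indicator sets_measure_pmf UNIV_I)
  also have "\<dots> = (\<integral>\<^sup>+a. \<integral>\<^sup>+w. ennreal (pmf q w) * indicator {w. P w \<and> A w = a} w \<partial>count_space UNIV \<partial>count_space UNIV)"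
    by (intro nn_integral_cong nn_integral_measure_pmf)
  also have "\<dots> = (\<integral>\<^sup>+w. \<integral>\<^sup>+a. ennreal (pmf q w) * indicator {w. P w \<and> A w = a} w \<partial>count_space UNIV \<partial>count_space UNIV)"
    using nn_integral_fst_count_space[of "\<lambda>(a, w). ennreal (pmf q w) * indicator {w. P w \<and> A w = a} w"]
      nn_integral_snd_count_space[of "\<lambda>(a, w). ennreal (pmf q w) * indicator {w. P w \<and> A w = a} w"]
    by simp
  also have "\<dots> = (\<integral>\<^sup>+w. ennreal (pmf q w) * indicator {w. P w} w \<partial>count_space UNIV)"
  proof (rule nn_integral_cong)
    fix w
    have "(\<integral>\<^sup>+a. ennreal (pmf q w) * indicator {w. P w \<and> A w = a} w \<partial>count_space UNIV)
       = (\<integral>\<^sup>+a. (ennreal (pmf q w) * indicator {w. P w} w) * indicator {A w} a \<partial>count_space UNIV)"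
      by (rule nn_integral_cong) (auto simp: indicator_def)
    also have "\<dots> = ennreal (pmf q w) * indicator {w. P w} w"
      by (simp add: nn_integral_cmult)
    finally show "(\<integral>\<^sup>+a. ennreal (pmf q w) * indicator {w. P w \<and> A w = a} w \<partial>count_space UNIV)
       = ennreal (pmf q w) * indicator {w. P w} w" .
  qed
  also have "\<dots> = (\<integral>\<^sup>+w. indicator {w. P w} w \<partial>measure_pmf q)"
    by (rule nn_integral_measure_pmf[symmetric])
  also have "\<dots> = emeasure (measure_pmf q) {w. P w}"
    by (simp only: nn_integral_indicator sets_measure_pmf UNIV_I)
  finally show ?thesis by simp
qed

text \<open>Summing out gives the marginals \<phi> T, S \<psi> and S T, and the product rule is then
  commutativity. The sums live in \<open>ennreal\<close> because nothing bounds the factors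
  separately.\<close>

lemma cond_indep_factorI:
  fixes \<phi> :: "'a \<Rightarrow> 'b \<Rightarrow> real" and \<psi> :: "'b \<Rightarrow> 'c \<Rightarrow> real"
  assumes f: "\<And>a b c. measure_pmf.prob q {w. A w = a \<and> B w = b \<and> C w = c} = \<phi> a b * \<psi> b c"
    and nn: "\<And>a b. \<phi> a b \<ge> 0" "\<And>b c. \<psi> b c \<ge> 0"
  shows "cond_indep q A B C"
  unfolding cond_indep_def
proof (intro allI)
  fix a b c
  define S where "S = (\<integral>\<^sup>+a. ennreal (\<phi> a b) \<partial>count_space UNIV)"
  define T where "T = (\<integral>\<^sup>+c. ennreal (\<psi> b c) \<partial>count_space UNIV)"
  have e: "emeasure (measure_pmf q) {w. A w = a \<and> B w = b \<and> C w = c} = ennreal (\<phi> a b) * ennreal (\<psi> b c)" for a b c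
    by (simp add: measure_pmf.emeasure_eq_measure f ennreal_mult nn)
  have ab: "emeasure (measure_pmf q) {w. A w = a \<and> B w = b} = ennreal (\<phi> a b) * T" for a
    using emeasure_partition[of q "\<lambda>w. A w = a \<and> B w = b" C]
    by (simp add: conj_ac e[simplified conj_ac] nn_integral_cmult T_def)
  have bc: "emeasure (measure_pmf q) {w. B w = b \<and> C w = c} = S * ennreal (\<psi> b c)"
    using emeasure_partition[of q "\<lambda>w. B w = b \<and> C w = c" A]
    by (simp add: conj_ac e[simplified conj_ac] nn_integral_multc S_def)
  have b: "emeasure (measure_pmf q) {w. B w = b} = S * T"
    using emeasure_partition[of q "\<lambda>w. B w = b" A]
    by (simp add: conj_ac ab[simplified conj_ac] nn_integral_multc S_def)
  have "emeasure (measure_pmf q) {w. A w = a \<and> B w = b \<and> C w = c} * emeasure (measure_pmf q) {w. B w = b}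
      = emeasure (measure_pmf q) {w. A w = a \<and> B w = b} * emeasure (measure_pmf q) {w. B w = b \<and> C w = c}"
    unfolding e ab bc b by (simp add: mult_ac)
  then show "measure_pmf.prob q {w. A w = a \<and> B w = b \<and> C w = c} * measure_pmf.prob q {w. B w = b}
      = measure_pmf.prob q {w. A w = a \<and> B w = b} * measure_pmf.prob q {w. B w = b \<and> C w = c}"
    by (simp add: measure_pmf.emeasure_eq_measure ennreal_mult[symmetric])
qed

text \<open>The factors are given on outcomes: v supplies the value of A, w that of C, and they are
  glued along a common value of B. Cutting and pasting of histories delivers the factorization in
  this form.\<close>

lemma cond_indep_glueI:
  fixes \<phi> \<psi> :: "'w \<Rightarrow> real"
  assumes f: "\<And>v w. B v = B w \<Longrightarrow>
      measure_pmf.prob q {x. A x = A v \<and> B x = B v \<and> C x = C w} = \<phi> v * \<psi> w"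
    and nn: "\<And>v. \<phi> v \<ge> 0" "\<And>v. \<psi> v \<ge> 0"
  shows "cond_indep q A B C"
proof (rule cond_indep_factorI)
  \<comment> \<open>Each factor is read off at a chosen representative outcome. Pairs of values that
    are never taken get 0, which agrees with the probability of an empty event.\<close>
  define \<phi>' where "\<phi>' a b = (if \<exists>v. A v = a \<and> B v = b then \<phi> (SOME v. A v = a \<and> B v = b) else 0)" for a b
  define \<psi>' where "\<psi>' b c = (if \<exists>v. B v = b \<and> C v = c then \<psi> (SOME v. B v = b \<and> C v = c) else 0)" for b c
  show "\<phi>' a b \<ge> 0" "\<psi>' b c \<ge> 0" for a b c
    by (auto simp: \<phi>'_def \<psi>'_def nn)
  fix a b c
  show "measure_pmf.prob q {w. A w = a \<and> B w = b \<and> C w = c} = \<phi>' a b * \<psi>' b c"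
  proof (cases "(\<exists>v. A v = a \<and> B v = b) \<and> (\<exists>v. B v = b \<and> C v = c)")
    case True
    define v where "v = (SOME v. A v = a \<and> B v = b)"
    define w where "w = (SOME v. B v = b \<and> C v = c)"
    have v: "A v = a \<and> B v = b"
      unfolding v_def by (rule someI_ex) (use True in blast)
    have w: "B w = b \<and> C w = c"
      unfolding w_def by (rule someI_ex) (use True in blast)
    from f[of v w] v w True show ?thesis
      by (simp add: \<phi>'_def \<psi>'_def v_def[symmetric] w_def[symmetric])
  next
    case False
    then have *: "{w. A w = a \<and> B w = b \<and> C w = c} = {}" by blast
    have "\<phi>' a b = 0 \<or> \<psi>' b c = 0"
      using False unfolding \<phi>'_def \<psi>'_def de_Morgan_conj
      by (elim disjE) (simp_all only: if_False simp_thms)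
    then show ?thesis unfolding * by auto
  qed
qed

text \<open>The identity P(a,b,c) = P(a,b) P(c|b) is summed over those values a that lead to the
  given value of A' on the support.\<close>

lemma cond_indep_coarsen_left:
  assumes ci: "cond_indep q A B C" and det: "determines q A A'"
  shows "cond_indep q A' B C"
proof (rule cond_indep_factorI)
  let ?P = "\<lambda>S. measure_pmf.prob q S"
  define \<psi> where "\<psi> b c = ?P {w. B w = b \<and> C w = c} / ?P {w. B w = b}" for b c
  have \<psi>_nn: "\<psi> b c \<ge> 0" for b c
    by (auto simp: \<psi>_def)
  show "?P {w. A' w = a \<and> B w = b} \<ge> 0" "\<psi> b c \<ge> 0" for a b c
    by (auto simp: \<psi>_def)
  fix a' b c
  have f: "?P {w. A w = a \<and> B w = b \<and> C w = c} = ?P {w. A w = a \<and> B w = b} * \<psi> b c" for a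
  proof (cases "?P {w. B w = b} = 0")
    case True
    have "?P {w. A w = a \<and> B w = b \<and> C w = c} \<le> ?P {w. B w = b}"
      by (rule prob_mono_supp) auto
    with True show ?thesis
      by (simp add: \<psi>_def) (simp add: measure_le_0_iff)
  next
    case False
    then show ?thesis
      using ci[unfolded cond_indep_def, rule_format, of a b c] by (simp add: \<psi>_def field_simps)
  qed
  define N where "N = {a. \<exists>w\<in>set_pmf q. A w = a \<and> A' w = a'}"
  have red: "emeasure (measure_pmf q) {w. (A' w = a' \<and> Q w) \<and> A w = a}
      = emeasure (measure_pmf q) {w. A w = a \<and> Q w} * indicator N a" for a Q
  proof (cases "a \<in> N")
    case True
    then have "A' w = a'" if "w \<in> set_pmf q" "A w = a" for w
      using that by (auto simp: N_def dest: determinesD[OF det])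
    then have "emeasure (measure_pmf q) {w. (A' w = a' \<and> Q w) \<and> A w = a} = emeasure (measure_pmf q) {w. A w = a \<and> Q w}"
      by (intro emeasure_eq_AE) (auto simp: AE_measure_pmf_iff)
    with True show ?thesis by simp
  next
    case False
    then have "emeasure (measure_pmf q) {w. (A' w = a' \<and> Q w) \<and> A w = a} = emeasure (measure_pmf q) {}"
      by (intro emeasure_eq_AE) (auto simp: AE_measure_pmf_iff N_def)
    with False show ?thesis by simp
  qed
  have "emeasure (measure_pmf q) {w. A' w = a' \<and> B w = b \<and> C w = c}
     = (\<integral>\<^sup>+a. emeasure (measure_pmf q) {w. A w = a \<and> B w = b \<and> C w = c} * indicator N a \<partial>count_space UNIV)"
    by (subst emeasure_partition[where A=A]) (simp only: red)
  also have "\<dots> = (\<integral>\<^sup>+a. emeasure (measure_pmf q) {w. A w = a \<and> B w = b} * indicator N a * ennreal (\<psi> b c) \<partial>count_space UNIV)"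
    by (simp add: measure_pmf.emeasure_eq_measure f ennreal_mult mult_ac \<psi>_nn)
  also have "\<dots> = (\<integral>\<^sup>+a. emeasure (measure_pmf q) {w. A w = a \<and> B w = b} * indicator N a \<partial>count_space UNIV) * ennreal (\<psi> b c)"
    by (rule nn_integral_multc) simp
  also have "(\<integral>\<^sup>+a. emeasure (measure_pmf q) {w. A w = a \<and> B w = b} * indicator N a \<partial>count_space UNIV)
      = emeasure (measure_pmf q) {w. A' w = a' \<and> B w = b}"
    by (subst (2) emeasure_partition[where A=A]) (simp only: red)
  finally show "?P {w. A' w = a' \<and> B w = b \<and> C w = c} = ?P {w. A' w = a' \<and> B w = b} * \<psi> b c"
    by (simp add: measure_pmf.emeasure_eq_measure ennreal_mult[symmetric] \<psi>_nn)
qed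

lemma cond_indep_coarsen:
  assumes "cond_indep q A B C" "determines q A A'" "determines q C C'"
  shows "cond_indep q A' B C'"
  by (rule cond_indep_commute[OF cond_indep_coarsen_left[OF
        cond_indep_commute[OF cond_indep_coarsen_left[OF assms(1,2)]] assms(3)]])

text \<open>The weak union rule; it allows the two links of a sender to be extended one after the
  other.\<close>

lemma cond_indep_weak_union:
  assumes ci: "cond_indep q (\<lambda>w. (A w, A' w)) B C"
  shows "cond_indep q A' (\<lambda>w. (A w, B w)) C"
proof -
  let ?P = "\<lambda>S. measure_pmf.prob q S"
  have ci': "cond_indep q A B C"
    by (rule cond_indep_coarsen[OF ci]) (auto simp: determines_def)
  show ?thesis
    unfolding cond_indep_def
  proof (intro allI, clarify)
    fix a' a b c
    let ?p = "?P {w. A' w = a' \<and> (A w, B w) = (a, b) \<and> C w = c}" 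
    have 1: "?p * ?P {w. B w = b} = ?P {w. A' w = a' \<and> (A w, B w) = (a, b)} * ?P {w. B w = b \<and> C w = c}"
      using ci[unfolded cond_indep_def, rule_format, of "(a, a')" b c] by (simp add: conj_ac)
    have 2: "?P {w. (A w, B w) = (a, b) \<and> C w = c} * ?P {w. B w = b} = ?P {w. (A w, B w) = (a, b)} * ?P {w. B w = b \<and> C w = c}"
      using ci'[unfolded cond_indep_def, rule_format, of a b c] by (simp add: conj_ac)
    show "?p * ?P {w. (A w, B w) = (a, b)} = ?P {w. A' w = a' \<and> (A w, B w) = (a, b)} * ?P {w. (A w, B w) = (a, b) \<and> C w = c}"
    proof (cases "?P {w. B w = b} = 0")
      case True
      have "?P {w. (A w, B w) = (a, b)} \<le> ?P {w. B w = b}" 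
        by (rule prob_mono_supp) auto
      moreover have "?P {w. (A w, B w) = (a, b) \<and> C w = c} \<le> ?P {w. B w = b}" 
        by (rule prob_mono_supp) auto
      ultimately have "?P {w. (A w, B w) = (a, b)} = 0" "?P {w. (A w, B w) = (a, b) \<and> C w = c} = 0"
        using True by (simp_all add: measure_le_0_iff)
      then show ?thesis by simp
    next
      case False
      have "(?p * ?P {w. (A w, B w) = (a, b)}) * ?P {w. B w = b}
         = (?P {w. A' w = a' \<and> (A w, B w) = (a, b)} * ?P {w. (A w, B w) = (a, b) \<and> C w = c}) * ?P {w. B w = b}"
        using 1 2 by algebra
      with False show ?thesis by simp
    qed
  qed
qed

subsection \<open>Sign of the interaction information along a protocol\<close>

text \<open>The inequality I(D;B|C) \<le> I(D;B), expanded so that only conditional entropies of D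
  occur.\<close>

definition coinfo_nonneg :: "'w pmf \<Rightarrow> ('w \<Rightarrow> 'a) \<Rightarrow> ('w \<Rightarrow> 'b) \<Rightarrow> ('w \<Rightarrow> 'c) \<Rightarrow> bool" where
  "coinfo_nonneg q B C D \<longleftrightarrow>
     cond_ent q D B + cond_ent q D C \<le> ent q D + cond_ent q D (\<lambda>w. (B w, C w))"

lemma coinfo_nonneg_const: "coinfo_nonneg q B C (\<lambda>_. d)"
  by (simp add: coinfo_nonneg_def cond_ent_determined determines_def)

lemma coinfo_nonneg_commute: "coinfo_nonneg q B C D \<Longrightarrow> coinfo_nonneg q C B D"
proof -
  have "cond_ent q D (\<lambda>w. (B w, C w)) = cond_ent q D (\<lambda>w. (C w, B w))"
    by (rule cond_ent_cong) (auto simp: determines_def)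
  then show "coinfo_nonneg q B C D \<Longrightarrow> coinfo_nonneg q C B D"
    by (simp add: coinfo_nonneg_def)
qed

text \<open>The sender is not an end of the link D. Its messages are independent of D given its own
  links, so H(D|B,C) is preserved, while H(D|B) and H(D|C) can only drop.\<close>

lemma coinfo_nonneg_opposite_step:
  assumes co: "coinfo_nonneg q B C D" and fin: "fin_ent q D"
    and ci: "cond_indep q (\<lambda>w. (B' w, C' w)) (\<lambda>w. (B w, C w)) D"
    and B': "determines q B' B" and C': "determines q C' C"
  shows "coinfo_nonneg q B' C' D"
proof -
  have "cond_ent q D (\<lambda>w. (B' w, C' w)) = cond_ent q D (\<lambda>w. ((B' w, C' w), (B w, C w)))"
    by (rule cond_ent_cong; rule determinesI) (auto intro: determinesD[OF B'] determinesD[OF C'])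
  also have "\<dots> = cond_ent q D (\<lambda>w. (B w, C w))"
    by (rule cond_ent_cond_indep[OF cond_indep_commute[OF ci]])
  finally have "cond_ent q D (\<lambda>w. (B' w, C' w)) = cond_ent q D (\<lambda>w. (B w, C w))" .
  with co cond_ent_mono[OF fin B'] cond_ent_mono[OF fin C'] show ?thesis
    by (simp add: coinfo_nonneg_def)
qed

text \<open>Extending B changes the co-information by I(B';C|B) - I(B';C|B,D), and the second term
  vanishes by \<open>ci\<close>.\<close>

lemma coinfo_nonneg_side_step:
  assumes co: "coinfo_nonneg q B C D" and fin: "fin_ent q D"
    and ci: "cond_indep q B' (\<lambda>w. (B w, D w)) C" and B': "determines q B' B"
  shows "coinfo_nonneg q B' C D"
proof -
  let ?s = "\<lambda>E w. surprisal q (\<lambda>w. (D w, E w)) w - surprisal q E w"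
  let ?I = "\<lambda>w. surprisal q (\<lambda>w. (B' w, B w)) w + surprisal q (\<lambda>w. (C w, B w)) w
      - surprisal q B w - surprisal q (\<lambda>w. (B' w, C w, B w)) w"
  \<comment> \<open>\<open>?W\<close> is the integrand of the change and consists of conditional
    surprisals of D, hence is integrable. Its pointwise equality with \<open>?I\<close> carries
    integrability over to a mutual information between variables of possibly infinite
    entropy.\<close>
  let ?W = "\<lambda>w. ?s (\<lambda>w. (B' w, C w)) w - ?s B' w - ?s (\<lambda>w. (B w, C w)) w + ?s B w"
  have iW: "integrable (measure_pmf q) ?W"
    by (intro Bochner_Integration.integrable_add Bochner_Integration.integrable_diff integrable_cond_surprisal fin)
  have eq: "AE w in measure_pmf q. ?W w = ?I w"
  proof (rule AE_pmfI)
    fix w assume w: "w \<in> set_pmf q"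
    have c: "surprisal q (\<lambda>w. (D w, B' w, C w)) w = surprisal q (\<lambda>w. (B' w, C w, (B w, D w))) w"
      "surprisal q (\<lambda>w. (D w, B w)) w = surprisal q (\<lambda>w. (B w, D w)) w"
      "surprisal q (\<lambda>w. (D w, B' w)) w = surprisal q (\<lambda>w. (B' w, (B w, D w))) w"
      "surprisal q (\<lambda>w. (D w, B w, C w)) w = surprisal q (\<lambda>w. (C w, (B w, D w))) w"
      "surprisal q (\<lambda>w. (B' w, B w)) w = surprisal q B' w"
      "surprisal q (\<lambda>w. (B' w, C w, B w)) w = surprisal q (\<lambda>w. (B' w, C w)) w"
      "surprisal q (\<lambda>w. (C w, B w)) w = surprisal q (\<lambda>w. (B w, C w)) w"
      using w by (auto intro!: surprisal_cong determinesI intro: determinesD[OF B'])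
    show "?W w = ?I w"
      unfolding c using cond_indep_surprisal[OF ci w] by linarith
  qed
  have "integrable (measure_pmf q) ?I"
    using iW by (rule integrable_cong_AE_imp) (use eq in auto)
  then have "0 \<le> (\<integral>w. ?I w \<partial>measure_pmf q)"
    by (rule cond_mutual_info_nonneg)
  also have "\<dots> = (\<integral>w. ?W w \<partial>measure_pmf q)"
    by (rule integral_cong_AE) (use eq in auto)
  also have "\<dots> = cond_ent q D (\<lambda>w. (B' w, C w)) - cond_ent q D B' - cond_ent q D (\<lambda>w. (B w, C w)) + cond_ent q D B"
    unfolding cond_ent_def
    by (simp only: Bochner_Integration.integral_add Bochner_Integration.integral_diff
        Bochner_Integration.integrable_add Bochner_Integration.integrable_diff integrable_cond_surprisal[OF fin])
  finally show ?thesis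
    using co by (simp add: coinfo_nonneg_def)
qed

text \<open>By the chain rule the change is H(D'|D) + H(D'|D,B,C) - H(D'|D,B) - H(D'|D,C). The two
  middle terms cancel by \<open>ci\<close>, which leaves I(D';C|D). The variable E is any encoding
  of (B,D), so that the condition produced by weak union fits.\<close>

lemma coinfo_nonneg_target_step:
  assumes co: "coinfo_nonneg q B C D" and fin: "fin_ent q D'"
    and ci: "cond_indep q D' E C" and D': "determines q D' D"
    and E: "determines q E (\<lambda>w. (B w, D w))" "determines q (\<lambda>w. (B w, D w)) E"
  shows "coinfo_nonneg q B C D'"
proof -
  have finD: "fin_ent q D" by (rule fin_ent_mono[OF fin D'])
  have split: "cond_ent q D' E = cond_ent q D E + cond_ent q D' (\<lambda>w. (D w, E w))" for E :: "_ \<Rightarrow> 'z"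
  proof -
    have "cond_ent q D' E = cond_ent q (\<lambda>w. (D w, D' w)) E"
      by (rule cond_ent_cong; rule determinesI) (auto intro: determinesD[OF D'])
    then show ?thesis by (simp add: cond_ent_chain[OF finD fin])
  qed
  have "cond_ent q D' (\<lambda>w. (D w, B w, C w)) = cond_ent q D' (\<lambda>w. (C w, E w))"
    by (rule cond_ent_cong; rule determinesI) (auto dest: determinesD[OF E(1)] determinesD[OF E(2), simplified])
  also have "\<dots> = cond_ent q D' E"
    by (rule cond_ent_cond_indep[OF ci])
  also have "\<dots> = cond_ent q D' (\<lambda>w. (D w, B w))"
    by (rule cond_ent_cong; rule determinesI) (auto dest: determinesD[OF E(1)] determinesD[OF E(2), simplified])
  finally have 1: "cond_ent q D' (\<lambda>w. (D w, B w, C w)) = cond_ent q D' (\<lambda>w. (D w, B w))" .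
  have 2: "cond_ent q D' (\<lambda>w. (D w, C w)) \<le> cond_ent q D' (\<lambda>w. (D w, ()))"
    by (rule cond_ent_mono[OF fin]) (auto simp: determines_def)
  show ?thesis
    using co 1 2 split[of B] split[of C] split[of "\<lambda>_. ()"] split[of "\<lambda>w. (B w, C w)"]
    unfolding coinfo_nonneg_def by linarith
qed

text \<open>The sender sits between the links B and D and extends both. Weak union separates this
  into an extension of B, followed by one of D given the new B.\<close>

lemma coinfo_nonneg_adjacent_step:
  assumes co: "coinfo_nonneg q B C D" and fin: "fin_ent q D'"
    and ci: "cond_indep q (\<lambda>w. (B' w, D' w)) (\<lambda>w. (B w, D w)) C"
    and B': "determines q B' B" and D': "determines q D' D"
  shows "coinfo_nonneg q B' C D'"
proof (rule coinfo_nonneg_target_step[OF coinfo_nonneg_side_step[OF co]])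
  show "fin_ent q D" by (rule fin_ent_mono[OF fin D'])
  show "cond_indep q B' (\<lambda>w. (B w, D w)) C"
    by (rule cond_indep_coarsen[OF ci]) (auto simp: determines_def)
  show "cond_indep q D' (\<lambda>w. (B' w, (B w, D w))) C"
    by (rule cond_indep_weak_union[OF ci])
  show "determines q (\<lambda>w. (B' w, (B w, D w))) (\<lambda>w. (B' w, D w))"
    by (auto simp: determines_def)
  show "determines q (\<lambda>w. (B' w, D w)) (\<lambda>w. (B' w, (B w, D w)))"
    by (rule determinesI) (auto intro: determinesD[OF B'])
qed fact+

subsection \<open>Residual information and normal form\<close>

lemma pmf_ent_map_pmf:
  assumes "finite (set_pmf (map_pmf A q))"
  shows "fin_ent q A" "pmf_ent (map_pmf A q) = ent q A"
proof -
  define g where "g a = - log 2 (pmf (map_pmf A q) a)" for a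
  have s: "surprisal q A w = g (A w)" for w
    by (simp add: surprisal_def g_def pr_def pmf_map vimage_def)
  have "integrable (measure_pmf (map_pmf A q)) g"
    by (rule integrable_measure_pmf_finite[OF assms])
  then show "fin_ent q A"
    unfolding fin_ent_def s by simp
  have "ent q A = (\<integral>w. surprisal q A w \<partial>measure_pmf q)"
    unfolding cond_ent_def surprisal_const diff_0_right
    by (intro integral_cong_AE AE_pmfI surprisal_cong) (auto simp: determines_def)
  also have "\<dots> = (\<integral>a. g a \<partial>measure_pmf (map_pmf A q))"
    unfolding s by simp
  also have "\<dots> = (\<Sum>a\<in>set_pmf (map_pmf A q). g a * pmf (map_pmf A q) a)"
    by (rule integral_measure_pmf_real[OF assms]) auto
  also have "\<dots> = pmf_ent (map_pmf A q)"
    by (simp add: pmf_ent_def g_def mult.commute)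
  finally show "pmf_ent (map_pmf A q) = ent q A" by simp
qed

lemma fin_ent_finite_type: "fin_ent q (A :: 'w \<Rightarrow> 'a::finite)"
  by (rule pmf_ent_map_pmf) simp

lemma ent_chain:
  assumes "fin_ent q A" "fin_ent q A'"
  shows "ent q (\<lambda>w. (A w, A' w)) = ent q A + cond_ent q A' A"
proof -
  have "cond_ent q A' (\<lambda>w. (A w, ())) = cond_ent q A' A"
    by (rule cond_ent_cong) (auto simp: determines_def)
  then show ?thesis
    using cond_ent_chain[OF assms, of "\<lambda>_. ()"] by simp
qed

lemma ent_le_determined:
  assumes "fin_ent q A" "determines q A B"
  shows "ent q B \<le> ent q A"
  by (rule cond_ent_mono_left)
    (use assms in \<open>auto intro!: determinesI intro: determinesD fin_ent_mono\<close>)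

text \<open>The supremum is one of reals, so it needs an upper bound: every common part is a
  function of the pair, and the entropy of the pair is finite.\<close>

lemma gk_common_ge:
  fixes q :: "('u::finite \<times> 'v::finite) pmf" and f :: "'u \<Rightarrow> nat" and g :: "'v \<Rightarrow> nat"
  assumes "\<And>u v. (u, v) \<in> set_pmf q \<Longrightarrow> f u = g v"
  shows "pmf_ent (map_pmf (\<lambda>uv. f (fst uv)) q) \<le> gk_common q"
  unfolding gk_common_def
proof (rule cSUP_upper2[where x="(f, g)"])
  show "bdd_above ((\<lambda>fg. pmf_ent (map_pmf (\<lambda>uv. fst fg (fst uv)) q)) `
    {(f :: 'u \<Rightarrow> nat, g :: 'v \<Rightarrow> nat). \<forall>uv\<in>set_pmf q. f (fst uv) = g (snd uv)})"
  proof (rule bdd_aboveI2)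
    fix fg :: "('u \<Rightarrow> nat) \<times> ('v \<Rightarrow> nat)"
    have "pmf_ent (map_pmf (\<lambda>uv. fst fg (fst uv)) q) = ent q (\<lambda>uv. fst fg (fst uv))"
      by (rule pmf_ent_map_pmf) simp
    also have "\<dots> \<le> ent q (\<lambda>uv. uv)"
      by (rule ent_le_determined[OF fin_ent_finite_type]) (simp add: determines_def)
    finally show "pmf_ent (map_pmf (\<lambda>uv. fst fg (fst uv)) q) \<le> ent q (\<lambda>uv. uv)" .
  qed
qed (use assms in auto)

lemma pmf_ent_swap: "pmf_ent (map_pmf prod.swap q) = pmf_ent q"
proof -
  have "pmf (map_pmf prod.swap q) (prod.swap x) = pmf q x" for x
    by (rule pmf_map_inj') simp
  then show ?thesis
    unfolding pmf_ent_def set_map_pmf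
    by (subst sum.reindex) (auto simp: inj_on_def)
qed

text \<open>A common part can be computed from either coordinate, because f and g agree on the
  support.\<close>

lemma resid_info_swap:
  fixes q :: "('a \<times> 'b) pmf"
  shows "resid_info (map_pmf prod.swap q) = resid_info q"
proof -
  define S where "S = {(f :: 'a \<Rightarrow> nat, g :: 'b \<Rightarrow> nat). \<forall>uv\<in>set_pmf q. f (fst uv) = g (snd uv)}"
  have S': "{(f :: 'b \<Rightarrow> nat, g :: 'a \<Rightarrow> nat). \<forall>uv\<in>set_pmf (map_pmf prod.swap q). f (fst uv) = g (snd uv)}
      = prod.swap ` S"
    by (force simp: S_def image_iff)
  have "gk_common (map_pmf prod.swap q) = (SUP fg\<in>S. pmf_ent (map_pmf (\<lambda>uv. snd fg (snd uv)) q))"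
    unfolding gk_common_def S' image_image by (simp add: pmf.map_comp o_def)
  also have "\<dots> = (SUP fg\<in>S. pmf_ent (map_pmf (\<lambda>uv. fst fg (fst uv)) q))"
    by (intro SUP_cong refl arg_cong[where f=pmf_ent] map_pmf_cong) (auto simp: S_def)
  also have "\<dots> = gk_common q"
    by (simp add: gk_common_def S_def)
  finally show ?thesis
    by (simp add: resid_info_def mutual_inf_def pmf_ent_swap pmf.map_comp o_def)
qed

lemma cond_prob_given_pair_eq:
  fixes U :: "'w \<Rightarrow> 'u" and V :: "'w \<Rightarrow> 'v" and Q :: "'w \<Rightarrow> 'b"
  assumes ci: "cond_indep q Q U V" and w: "w \<in> set_pmf q"
  shows "measure_pmf.prob q {x. Q x = b \<and> U x = U w \<and> V x = V w} / measure_pmf.prob q {x. U x = U w \<and> V x = V w}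
       = measure_pmf.prob q {x. Q x = b \<and> U x = U w} / measure_pmf.prob q {x. U x = U w}"
proof -
  have "measure_pmf.prob q {x. U x = U w} > 0" "measure_pmf.prob q {x. U x = U w \<and> V x = V w} > 0"
    using w by (auto intro: measure_pmf_posI)
  then show ?thesis
    using ci[unfolded cond_indep_def, rule_format, of b "U w" "V w"] by (simp add: field_simps)
qed

text \<open>Under both Markov chains, the conditional law of \<^term>\<open>Q\<close> given the pair is a function of
  \<^term>\<open>U\<close> alone and of \<^term>\<open>V\<close> alone, so (a label of) this law is a common part of the pair
  that separates \<^term>\<open>V\<close> from \<^term>\<open>Q\<close>.\<close>
lemma resid_info_le_cond_mutual_info:
  fixes U :: "'w \<Rightarrow> 'u::finite" and V :: "'w \<Rightarrow> 'v::finite" and Q :: "'w \<Rightarrow> 'b"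
  assumes ciU: "cond_indep q Q U V" and ciV: "cond_indep q Q V U"
  shows "resid_info (map_pmf (\<lambda>w. (U w, V w)) q) \<le> cond_ent q V Q - cond_ent q V (\<lambda>w. (U w, Q w))"
proof -
  let ?P = "\<lambda>S. measure_pmf.prob q S"
  define lU where "lU u = (\<lambda>b. ?P {w. Q w = b \<and> U w = u} / ?P {w. U w = u})" for u
  define lV where "lV v = (\<lambda>b. ?P {w. Q w = b \<and> V w = v} / ?P {w. V w = v})" for v
  \<comment> \<open>Only finitely many conditional laws occur, so they can be numbered;
    \<open>gk_common\<close> admits common parts with values in \<open>nat\<close>.\<close>
  define S where "S = range lU \<union> range lV"
  define f where "f u = to_nat_on S (lU u)" for u
  define g where "g v = to_nat_on S (lV v)" for v
  define K where "K = (\<lambda>w. f (U w))"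
  have "finite S" by (simp add: S_def)
  then have cS: "countable S" by (rule countable_finite)
  have fnS: "from_nat_into S (g v) = lV v" for v
    unfolding g_def by (rule from_nat_into_to_nat_on[OF cS]) (simp add: S_def)
  have l: "lU (U w) = lV (V w)" if "w \<in> set_pmf q" for w
  proof
    fix b
    show "lU (U w) b = lV (V w) b"
      using cond_prob_given_pair_eq[OF ciU that, of b] cond_prob_given_pair_eq[OF ciV that, of b]
      by (simp add: lU_def lV_def conj_ac)
  qed
  then have fg: "f (U w) = g (V w)" if "w \<in> set_pmf q" for w
    using that by (simp add: f_def g_def)
  \<comment> \<open>Given K = k, the law of Q is the one numbered k, whatever V is; decoding k
    therefore yields the second factor.\<close>
  have ciK: "cond_indep q V K Q"
  proof (rule cond_indep_factorI)
    have nn: "x b \<ge> 0" if "x \<in> S" for x b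
      using that by (auto simp: S_def lU_def lV_def)
    show "?P {w. V w = v \<and> K w = k} \<ge> 0" for v k by simp
    show "from_nat_into S k b \<ge> 0" for k b
      by (rule nn) (rule from_nat_into, simp add: S_def)
    fix v k b
    show "?P {w. V w = v \<and> K w = k \<and> Q w = b} = ?P {w. V w = v \<and> K w = k} * from_nat_into S k b"
    proof (cases "g v = k")
      case True
      have "?P {w. V w = v \<and> K w = k \<and> Q w = b} = ?P {w. Q w = b \<and> V w = v}"
        "?P {w. V w = v \<and> K w = k} = ?P {w. V w = v}"
        by (rule prob_cong_supp; use fg True in \<open>auto simp: K_def\<close>)+
      moreover have "?P {w. Q w = b \<and> V w = v} \<le> ?P {w. V w = v}"
        by (rule prob_mono_supp) auto
      moreover have "?P {w. Q w = b \<and> V w = v} \<ge> 0" by simp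
      ultimately show ?thesis
        using True fnS[of v] by (auto simp: lV_def intro!: antisym)
    next
      case False
      have "?P {w. V w = v \<and> K w = k \<and> Q w = b} = ?P {w. False}" "?P {w. V w = v \<and> K w = k} = ?P {w. False}"
        by (rule prob_cong_supp; use fg False in \<open>auto simp: K_def\<close>)+
      then show ?thesis by simp
    qed
  qed
  have finK: "fin_ent q K"
    by (rule fin_ent_mono[OF fin_ent_finite_type[of q U]]) (simp add: K_def determines_def)
  note fin = fin_ent_finite_type[of q U] fin_ent_finite_type[of q V] finK
  \<comment> \<open>The estimate is I(U;V|Q) = H(V|Q) - H(V|U) \<ge> H(V|K) - H(V|U) \<ge> H(V) -
    H(K) - H(V|U) = I(U;V) - H(K), and H(K) is at most the entropy of the maximal common
    part.\<close>
  have "cond_ent q V (\<lambda>w. (Q w, K w)) \<le> cond_ent q V Q"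
    by (rule cond_ent_mono[OF fin(2)]) (simp add: determines_def)
  moreover have "cond_ent q V (\<lambda>w. (Q w, K w)) = cond_ent q V K"
    by (rule cond_ent_cond_indep[OF ciK])
  moreover have "ent q (\<lambda>w. (K w, V w)) = ent q K + cond_ent q V K"
    by (rule ent_chain[OF fin(3,2)])
  moreover have "ent q V \<le> ent q (\<lambda>w. (K w, V w))"
    by (rule ent_le_determined[OF fin_ent_Pair[OF fin(3,2)]]) (simp add: determines_def)
  moreover have "cond_ent q V (\<lambda>w. (U w, Q w)) = cond_ent q V (\<lambda>w. (Q w, U w))"
    by (rule cond_ent_cong) (auto simp: determines_def)
  moreover have "cond_ent q V (\<lambda>w. (Q w, U w)) = cond_ent q V U"
    by (rule cond_ent_cond_indep[OF cond_indep_commute[OF ciU]])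
  moreover have "ent q (\<lambda>w. (U w, V w)) = ent q U + cond_ent q V U"
    by (rule ent_chain[OF fin(1,2)])
  moreover have "ent q K \<le> gk_common (map_pmf (\<lambda>w. (U w, V w)) q)"
  proof -
    have "pmf_ent (map_pmf (\<lambda>uv. f (fst uv)) (map_pmf (\<lambda>w. (U w, V w)) q)) \<le> gk_common (map_pmf (\<lambda>w. (U w, V w)) q)"
      by (rule gk_common_ge[of _ f g]) (use fg in auto)
    moreover have "pmf_ent (map_pmf K q) = ent q K"
      by (rule pmf_ent_map_pmf) (simp add: K_def finite_subset[OF _ finite_imageI[OF finite_class.finite_UNIV, of f]] image_subset_iff)
    ultimately show ?thesis
      by (simp add: pmf.map_comp o_def K_def)
  qed
  moreover have "mutual_inf (map_pmf (\<lambda>w. (U w, V w)) q) = ent q U + ent q V - ent q (\<lambda>w. (U w, V w))"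
    by (simp add: mutual_inf_def pmf.map_comp o_def pmf_ent_map_pmf)
  ultimately show ?thesis
    unfolding resid_info_def by linarith
qed

text \<open>If U = u and V = t can occur together, the two Markov chains give P(W|U=u) = P(W|V=t).
  All values of U compatible with t thus have proportional rows in the joint law with W, and
  \<open>nf\<close> identifies them.\<close>

lemma determines_by_normal_form:
  assumes ci: "cond_indep q U V W" and sec: "cond_indep q V U W"
    and nf: "\<And>u u' c. c \<ge> 0 \<Longrightarrow> (\<And>x. measure_pmf.prob q {w. U w = u \<and> W w = x}
        = c * measure_pmf.prob q {w. U w = u' \<and> W w = x}) \<Longrightarrow> u = u'"
  shows "determines q V U"
proof (rule determinesI)
  fix v w assume vw: "v \<in> set_pmf q" "w \<in> set_pmf q" "V v = V w"
  let ?P = "\<lambda>S. measure_pmf.prob q S"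
  let ?t = "V w"
  have *: "?P {x. U x = U y \<and> W x = z} * ?P {x. V x = ?t} = ?P {x. U x = U y} * ?P {x. V x = ?t \<and> W x = z}"
    if "y \<in> set_pmf q" "V y = ?t" for y z
  proof -
    have "?P {x. U x = U y \<and> V x = ?t} > 0"
      using that by (auto intro: measure_pmf_posI)
    moreover have "?P {x. U x = U y \<and> V x = ?t \<and> W x = z} * ?P {x. V x = ?t}
        = ?P {x. U x = U y \<and> V x = ?t} * ?P {x. V x = ?t \<and> W x = z}"
      using ci[unfolded cond_indep_def] by blast
    moreover have "?P {x. U x = U y \<and> V x = ?t \<and> W x = z} * ?P {x. U x = U y}
        = ?P {x. U x = U y \<and> V x = ?t} * ?P {x. U x = U y \<and> W x = z}"
      using sec[unfolded cond_indep_def, rule_format, of ?t "U y" z] by (simp add: conj_ac)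
    ultimately have "?P {x. U x = U y \<and> V x = ?t} * (?P {x. U x = U y \<and> W x = z} * ?P {x. V x = ?t})
        = ?P {x. U x = U y \<and> V x = ?t} * (?P {x. U x = U y} * ?P {x. V x = ?t \<and> W x = z})"
      by algebra
    with \<open>?P {x. U x = U y \<and> V x = ?t} > 0\<close> show ?thesis by simp
  qed
  have pos: "?P {x. V x = ?t} > 0" "?P {x. U x = U v} > 0" "?P {x. U x = U w} > 0"
    using vw by (auto intro: measure_pmf_posI)
  show "U v = U w"
  proof (rule nf[of "?P {x. U x = U v} / ?P {x. U x = U w}"])
    fix z
    have "(?P {x. U x = U v \<and> W x = z} * ?P {x. U x = U w}) * ?P {x. V x = ?t}
        = (?P {x. U x = U v} * ?P {x. U x = U w \<and> W x = z}) * ?P {x. V x = ?t}"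
      using *[OF vw(1,3), of z] *[OF vw(2) refl, of z] by algebra
    then show "?P {x. U x = U v \<and> W x = z} = ?P {x. U x = U v} / ?P {x. U x = U w} * ?P {x. U x = U w \<and> W x = z}"
      using pos by (simp add: field_simps)
  qed simp
qed

subsection \<open>Passage to the limit\<close>

text \<open>Only the limit 0 needs care: there x log x is continuous from the right, as the
  substitution x = 1/y reduces it to ln y / y at infinity.\<close>

lemma tendsto_mult_log:
  fixes p :: "nat \<Rightarrow> real"
  assumes p: "p \<longlonglongrightarrow> c" and nn: "\<And>n. p n \<ge> 0"
  shows "(\<lambda>n. p n * log 2 (p n)) \<longlonglongrightarrow> c * log 2 c"
proof (cases "c = 0")
  case False
  with LIMSEQ_le_const[OF p] nn have "c > 0" by force
  then show ?thesis
    by (intro tendsto_intros p) auto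
next
  case True
  have "((\<lambda>x::real. x * log 2 x) \<longlongrightarrow> 0) (at_right 0)"
  proof (subst filterlim_at_right_to_top)
    have "((\<lambda>x::real. - (ln x / x) / ln 2) \<longlongrightarrow> - 0 / ln 2) at_top"
      by (intro tendsto_intros ln_x_over_x_tendsto_0) simp
    then have "((\<lambda>x::real. - (ln x / x) / ln 2) \<longlongrightarrow> 0) at_top" by simp
    then show "((\<lambda>x::real. inverse x * log 2 (inverse x)) \<longlongrightarrow> 0) at_top"
      by (rule tendsto_cong[THEN iffD1, rotated])
        (auto simp: log_def ln_inverse divide_inverse mult_ac intro!: eventually_mono[OF eventually_gt_at_top[of 0]])
  qed
  moreover have "(0::real) * log 2 0 = 0" by simp
  ultimately have "continuous (at 0 within {0..}) (\<lambda>x::real. x * log 2 x)"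
    unfolding continuous_within by (simp add: at_within_Ici_at_right)
  from continuous_within_tendsto_compose'[OF this, of p sequentially] nn p show ?thesis
    by (simp add: True)
qed

lemma ent_finite_sum:
  fixes A :: "'w \<Rightarrow> 'a::finite"
  shows "ent q A = (\<Sum>a\<in>UNIV. - (measure_pmf.prob q {w. A w = a} * log 2 (measure_pmf.prob q {w. A w = a})))"
proof -
  have "ent q A = pmf_ent (map_pmf A q)"
    by (rule pmf_ent_map_pmf(2)[symmetric]) simp
  also have "\<dots> = (\<Sum>a\<in>UNIV. - (pmf (map_pmf A q) a * log 2 (pmf (map_pmf A q) a)))"
    unfolding pmf_ent_def by (rule sum.mono_neutral_cong_left) (auto simp: pmf_eq_0_set_pmf)
  finally show ?thesis by (simp add: pmf_map vimage_def)
qed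

lemma prob_tendsto:
  assumes "\<And>w. w \<in> set_pmf q \<Longrightarrow> \<forall>\<^sub>F n in sequentially. P n w \<longleftrightarrow> Q w"
  shows "(\<lambda>n. measure_pmf.prob q {w. P n w}) \<longlonglongrightarrow> measure_pmf.prob q {w. Q w}"
proof -
  have "(\<lambda>n. \<integral>w. indicator {w. P n w} w \<partial>measure_pmf q) \<longlonglongrightarrow> (\<integral>w. (indicator {w. Q w} w :: real) \<partial>measure_pmf q)"
  proof (rule integral_dominated_convergence[where w="\<lambda>_. 1"])
    show "AE w in measure_pmf q. (\<lambda>n. indicator {w. P n w} w :: real) \<longlonglongrightarrow> indicator {w. Q w} w"
    proof (rule AE_pmfI)
      fix w assume "w \<in> set_pmf q"
      from assms[OF this] show "(\<lambda>n. indicator {w. P n w} w :: real) \<longlonglongrightarrow> indicator {w. Q w} w"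
        by (intro tendsto_eventually) (auto elim!: eventually_mono simp: indicator_def)
    qed
  qed (auto simp: indicator_def)
  then show ?thesis by simp
qed

lemma ent_tendsto:
  fixes A :: "'w \<Rightarrow> 'a::finite"
  assumes "\<And>w. w \<in> set_pmf q \<Longrightarrow> \<forall>\<^sub>F n in sequentially. As n w = A w"
  shows "(\<lambda>n. ent q (As n)) \<longlonglongrightarrow> ent q A"
  unfolding ent_finite_sum
proof (intro tendsto_sum tendsto_minus tendsto_mult_log prob_tendsto)
  fix a w assume "w \<in> set_pmf q"
  from assms[OF this] show "\<forall>\<^sub>F n in sequentially. (As n w = a) = (A w = a)"
    by (auto elim!: eventually_mono)
qed simp

text \<open>V may have infinite entropy, so continuity of entropy is applied to finite-valued
  guesses instead: a decoder g of U from V, applied to \<open>Vs n\<close>, converges to U, and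
  H(U|Vs n) \<le> H(U|g(Vs n)).\<close>

lemma cond_ent_tendsto_0:
  fixes U :: "'w \<Rightarrow> 'u::finite" and Vs :: "nat \<Rightarrow> 'w \<Rightarrow> 'v"
  assumes lim: "\<And>w. w \<in> set_pmf q \<Longrightarrow> \<forall>\<^sub>F n in sequentially. Vs n w = V w"
    and det: "determines q V U"
  shows "(\<lambda>n. cond_ent q U (Vs n)) \<longlonglongrightarrow> 0"
proof -
  define g where "g v = U (SOME w. w \<in> set_pmf q \<and> V w = v)" for v
  have g: "g (V w) = U w" if w: "w \<in> set_pmf q" for w
  proof -
    have "(SOME x. x \<in> set_pmf q \<and> V x = V w) \<in> set_pmf q \<and> V (SOME x. x \<in> set_pmf q \<and> V x = V w) = V w"
      by (rule someI[of "\<lambda>x. x \<in> set_pmf q \<and> V x = V w" w]) (simp add: w)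
    then show ?thesis
      unfolding g_def using w by (intro determinesD[OF det]) auto
  qed
  define Us where "Us n = (\<lambda>w. g (Vs n w))" for n
  have ev: "\<forall>\<^sub>F n in sequentially. Us n w = U w" if "w \<in> set_pmf q" for w
    using lim[OF that] by eventually_elim (simp add: Us_def g[OF that])
  have "(\<lambda>n. ent q (\<lambda>w. (Us n w, U w)) - ent q (Us n)) \<longlonglongrightarrow> ent q (\<lambda>w. (U w, U w)) - ent q U"
    by (intro tendsto_diff ent_tendsto) (use ev in \<open>auto elim!: eventually_mono\<close>)
  moreover have "ent q (\<lambda>w. (U w, U w)) = ent q U"
    by (rule cond_ent_cong) (auto simp: determines_def)
  moreover have "ent q (\<lambda>w. (Us n w, U w)) - ent q (Us n) = cond_ent q U (Us n)" for n
    by (simp add: ent_chain fin_ent_finite_type)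
  ultimately have lim0: "(\<lambda>n. cond_ent q U (Us n)) \<longlonglongrightarrow> 0" by simp
  show ?thesis
  proof (rule tendsto_sandwich[OF _ _ tendsto_const lim0]; rule always_eventually; rule allI)
    fix n
    show "0 \<le> cond_ent q U (Vs n)" by (rule cond_ent_nonneg)
    show "cond_ent q U (Vs n) \<le> cond_ent q U (Us n)"
      by (rule cond_ent_mono[OF fin_ent_finite_type]) (auto simp: determines_def Us_def)
  qed
qed

text \<open>The bound I(X;Y|B) \<le> I(C;D|B) would be data processing if X were a function of (B,C)
  and Y of (B,D). After finitely many rounds this may fail, and H(X|B,C) and H(Y|B,D) pay for the
  failure.\<close>

lemma cond_mutual_info_data_processing:
  fixes X :: "'w \<Rightarrow> 'x::finite" and Y :: "'w \<Rightarrow> 'y::finite"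
  assumes fin: "fin_ent q D"
  shows "cond_ent q Y B - cond_ent q Y (\<lambda>w. (X w, B w)) - cond_ent q X (\<lambda>w. (B w, C w)) - cond_ent q Y (\<lambda>w. (B w, D w))
    \<le> cond_ent q D B - cond_ent q D (\<lambda>w. (B w, C w))"
proof -
  let ?H = "cond_ent q"
  note finX = fin_ent_finite_type[of q X] and finY = fin_ent_finite_type[of q Y]
  have "?H (\<lambda>w. (D w, Y w)) B = ?H D B + ?H Y (\<lambda>w. (D w, B w))"
    by (rule cond_ent_chain[OF fin finY])
  moreover have "?H (\<lambda>w. (D w, Y w)) B = ?H (\<lambda>w. (Y w, D w)) B"
    by (rule cond_ent_cong) (auto simp: determines_def)
  moreover have "?H (\<lambda>w. (Y w, D w)) B = ?H Y B + ?H D (\<lambda>w. (Y w, B w))"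
    by (rule cond_ent_chain[OF finY fin])
  moreover have "?H Y (\<lambda>w. (D w, B w)) = ?H Y (\<lambda>w. (B w, D w))"
    by (rule cond_ent_cong) (auto simp: determines_def)
  moreover have "?H D (\<lambda>w. (B w, C w)) \<le> ?H (\<lambda>w. (Y w, D w)) (\<lambda>w. (B w, C w))"
    by (rule cond_ent_mono_left[OF fin_ent_Pair[OF finY fin] _ fin]) (auto simp: determines_def)
  moreover have "?H (\<lambda>w. (Y w, D w)) (\<lambda>w. (B w, C w)) = ?H Y (\<lambda>w. (B w, C w)) + ?H D (\<lambda>w. (Y w, B w, C w))"
    by (rule cond_ent_chain[OF finY fin])
  moreover have "?H D (\<lambda>w. (Y w, B w, C w)) \<le> ?H D (\<lambda>w. (Y w, B w))"
    by (rule cond_ent_mono[OF fin]) (auto simp: determines_def)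
  moreover have "?H Y (\<lambda>w. (B w, C w)) \<le> ?H (\<lambda>w. (X w, Y w)) (\<lambda>w. (B w, C w))"
    by (rule cond_ent_mono_left[OF fin_ent_Pair[OF finX finY] _ finY]) (auto simp: determines_def)
  moreover have "?H (\<lambda>w. (X w, Y w)) (\<lambda>w. (B w, C w)) = ?H X (\<lambda>w. (B w, C w)) + ?H Y (\<lambda>w. (X w, B w, C w))"
    by (rule cond_ent_chain[OF finX finY])
  moreover have "?H Y (\<lambda>w. (X w, B w, C w)) \<le> ?H Y (\<lambda>w. (X w, B w))"
    by (rule cond_ent_mono[OF finY]) (auto simp: determines_def)
  ultimately show ?thesis by linarith
qed

text \<open>All links together determine Y and Z up to the two error terms, so H(D|B,C) is at least
  H(Y,Z|B,C) minus these errors. Adding X to the condition only lowers that entropy, and privacy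
  turns the result into H(Y,Z|X).\<close>

lemma cond_ent_ge_outputs:
  fixes X :: "'w \<Rightarrow> 'x::finite" and Y :: "'w \<Rightarrow> 'y::finite" and Z :: "'w \<Rightarrow> 'z::finite"
  assumes fin: "fin_ent q D" and ci: "cond_indep q (\<lambda>w. (B w, C w)) X (\<lambda>w. (Y w, Z w))"
  shows "ent q (\<lambda>w. (X w, Y w, Z w)) - ent q X - cond_ent q Y (\<lambda>w. (B w, D w)) - cond_ent q Z (\<lambda>w. (C w, D w))
    \<le> cond_ent q D (\<lambda>w. (B w, C w))"
proof -
  let ?H = "cond_ent q"
  let ?YZ = "\<lambda>w. (Y w, Z w)"
  note finX = fin_ent_finite_type[of q X] and finY = fin_ent_finite_type[of q Y]
    and finZ = fin_ent_finite_type[of q Z] and finYZ = fin_ent_finite_type[of q ?YZ]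
  have "?H ?YZ (\<lambda>w. (B w, C w)) \<le> ?H (\<lambda>w. (D w, ?YZ w)) (\<lambda>w. (B w, C w))"
    by (rule cond_ent_mono_left[OF fin_ent_Pair[OF fin finYZ] _ finYZ]) (auto simp: determines_def)
  moreover have "?H (\<lambda>w. (D w, ?YZ w)) (\<lambda>w. (B w, C w)) = ?H D (\<lambda>w. (B w, C w)) + ?H ?YZ (\<lambda>w. (D w, B w, C w))"
    by (rule cond_ent_chain[OF fin finYZ])
  moreover have "?H ?YZ (\<lambda>w. (D w, B w, C w)) = ?H Y (\<lambda>w. (D w, B w, C w)) + ?H Z (\<lambda>w. (Y w, D w, B w, C w))"
    by (rule cond_ent_chain[OF finY finZ])
  moreover have "?H Y (\<lambda>w. (D w, B w, C w)) \<le> ?H Y (\<lambda>w. (B w, D w))"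
    by (rule cond_ent_mono[OF finY]) (auto simp: determines_def)
  moreover have "?H Z (\<lambda>w. (Y w, D w, B w, C w)) \<le> ?H Z (\<lambda>w. (C w, D w))"
    by (rule cond_ent_mono[OF finZ]) (auto simp: determines_def)
  moreover have "?H ?YZ (\<lambda>w. ((B w, C w), X w)) \<le> ?H ?YZ (\<lambda>w. (B w, C w))"
    by (rule cond_ent_mono[OF finYZ]) (auto simp: determines_def)
  moreover have "?H ?YZ (\<lambda>w. ((B w, C w), X w)) = ?H ?YZ X"
    by (rule cond_ent_cond_indep[OF cond_indep_commute[OF ci]])
  moreover have "ent q (\<lambda>w. (X w, ?YZ w)) = ent q X + ?H ?YZ X"
    by (rule ent_chain[OF finX finYZ])
  ultimately show ?thesis by simp
qed

text \<open>Since \<open>D n\<close> is a function of L, H(L) dominates H(D n) for every n, so only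
  the error terms have to converge.\<close>

lemma entropy_bound_of_approximations:
  fixes X :: "'w \<Rightarrow> 'x::finite" and Y :: "'w \<Rightarrow> 'y::finite" and Z :: "'w \<Rightarrow> 'z::finite"
    and B C D :: "nat \<Rightarrow> 'w \<Rightarrow> 'b" and L :: "'w \<Rightarrow> 'l"
  assumes fin: "fin_ent q L" and L: "\<And>n. determines q L (D n)"
    and co: "\<And>n. coinfo_nonneg q (B n) (C n) (D n)"
    and secX: "\<And>n. cond_indep q (\<lambda>w. (B n w, C n w)) X (\<lambda>w. (Y w, Z w))"
    and secY: "\<And>n. cond_indep q (\<lambda>w. (B n w, D n w)) Y (\<lambda>w. (X w, Z w))"
    and secZ: "\<And>n. cond_indep q (\<lambda>w. (C n w, D n w)) Z (\<lambda>w. (X w, Y w))"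
    and limX: "(\<lambda>n. cond_ent q X (\<lambda>w. (B n w, C n w))) \<longlonglongrightarrow> 0"
    and limY: "(\<lambda>n. cond_ent q Y (\<lambda>w. (B n w, D n w))) \<longlonglongrightarrow> 0"
    and limZ: "(\<lambda>n. cond_ent q Z (\<lambda>w. (C n w, D n w))) \<longlonglongrightarrow> 0"
  shows "resid_info (map_pmf (\<lambda>w. (X w, Z w)) q) + resid_info (map_pmf (\<lambda>w. (X w, Y w)) q)
      + (ent q (\<lambda>w. (X w, Y w, Z w)) - ent q X) \<le> ent q L" (is "?r \<le> _")
proof -
  let ?eX = "\<lambda>n. cond_ent q X (\<lambda>w. (B n w, C n w))"
  let ?eY = "\<lambda>n. cond_ent q Y (\<lambda>w. (B n w, D n w))"
  let ?eZ = "\<lambda>n. cond_ent q Z (\<lambda>w. (C n w, D n w))"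
  \<comment> \<open>Every error occurs twice: X in both data processing bounds, Y and Z in one of
    them each and again in the bound on H(D|B,C).\<close>
  have step: "?r - 2 * ?eX n - 2 * ?eY n - 2 * ?eZ n \<le> ent q L" for n
  proof -
    have finD: "fin_ent q (D n)" by (rule fin_ent_mono[OF fin L])
    have e: "cond_ent q X (\<lambda>w. (C n w, B n w)) = ?eX n"
      "cond_ent q (D n) (\<lambda>w. (C n w, B n w)) = cond_ent q (D n) (\<lambda>w. (B n w, C n w))"
      by (rule cond_ent_cong; auto simp: determines_def)+
    have "resid_info (map_pmf (\<lambda>w. (X w, Y w)) q) \<le> cond_ent q Y (B n) - cond_ent q Y (\<lambda>w. (X w, B n w))"
      by (rule resid_info_le_cond_mutual_info; rule cond_indep_coarsen, rule secX secY) (auto simp: determines_def)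
    moreover have "resid_info (map_pmf (\<lambda>w. (X w, Z w)) q) \<le> cond_ent q Z (C n) - cond_ent q Z (\<lambda>w. (X w, C n w))"
      by (rule resid_info_le_cond_mutual_info; rule cond_indep_coarsen, rule secX secZ) (auto simp: determines_def)
    moreover note cond_mutual_info_data_processing[OF finD, of Y "B n" X "C n"]
      cond_mutual_info_data_processing[OF finD, of Z "C n" X "B n", unfolded e]
      cond_ent_ge_outputs[OF finD secX[of n]]
      ent_le_determined[OF fin L, of n] co[of n, unfolded coinfo_nonneg_def] cond_ent_nonneg[of q X "\<lambda>w. (B n w, C n w)"]
    ultimately show ?thesis by linarith
  qed
  have "(\<lambda>n. ?r - 2 * ?eX n - 2 * ?eY n - 2 * ?eZ n) \<longlonglongrightarrow> ?r - 2 * 0 - 2 * 0 - 2 * 0"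
    by (intro tendsto_intros limX limY limZ)
  then show ?thesis
    using step by (intro LIMSEQ_le_const2[of _ ?r "ent q L"]) auto
qed

subsection \<open>Message histories\<close>

lemma UNIV_party: "UNIV = {PA, PB, PC}"
  using party.exhaust by auto

instance party :: finite
  by standard (simp add: UNIV_party)

text \<open>The entry for i itself is None because \<open>hist\<close> records no message to
  oneself; the view of the actual messages is thus exactly the argument passed to
  \<open>nm\<close>.\<close>

definition view :: "(nat \<Rightarrow> party \<Rightarrow> party \<Rightarrow> 'm option) \<Rightarrow> party \<Rightarrow> nat \<Rightarrow> (party \<Rightarrow> 'm option) list" where
  "view h i t = map (\<lambda>s k. if k = i then None else h s k i) [0..<t]"

text \<open>A condition on the randomness of a single party. A history occurs exactly when all
  parties follow it, which makes its probability a product.\<close>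

definition follows :: "(party \<Rightarrow> party \<Rightarrow> nat \<Rightarrow> 'r \<Rightarrow> (party \<Rightarrow> 'm option) list \<Rightarrow> 'm option)
    \<Rightarrow> (nat \<Rightarrow> party \<Rightarrow> party \<Rightarrow> 'm option) \<Rightarrow> party \<Rightarrow> nat \<Rightarrow> 'r \<Rightarrow> bool" where
  "follows nm h i n r \<longleftrightarrow> (\<forall>t<n. \<forall>j. j \<noteq> i \<longrightarrow> nm i j t r (view h i t) = h t i j)"

lemma length_hist [simp]: "length (hist nm r t) = t"
  by (induction t) auto

lemma nth_hist: "s < t \<Longrightarrow> hist nm r t ! s = (\<lambda>i j. msg nm r s i j)"
proof (induction t)
  case (Suc t)
  show ?case
  proof (cases "s = t")
    case False
    with Suc show ?thesis by (simp add: nth_append)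
  qed (simp add: msg_def)
qed simp

lemma msg_self [simp]: "msg nm r t i i = None"
  by (simp add: msg_def nth_append)

lemma msg_eq_view: "i \<noteq> j \<Longrightarrow> msg nm r t i j = nm i j t (r i) (view (msg nm r) i t)"
proof -
  have "map (\<lambda>rd k. rd k i) (hist nm r t) = view (msg nm r) i t"
    by (rule nth_equalityI) (auto simp: view_def nth_hist)
  then show "i \<noteq> j \<Longrightarrow> ?thesis"
    by (simp add: msg_def nth_append)
qed

lemma view_cong:
  assumes "\<And>s k. s < t \<Longrightarrow> k \<noteq> i \<Longrightarrow> h s k i = h' s k i"
  shows "view h i t = view h' i t"
  using assms by (auto simp: view_def fun_eq_iff)

lemma follows_cong:
  assumes "\<And>t j. t < n \<Longrightarrow> j \<noteq> i \<Longrightarrow> h t i j = h' t i j"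
    and "\<And>t k. Suc t < n \<Longrightarrow> k \<noteq> i \<Longrightarrow> h t k i = h' t k i"
  shows "follows nm h i n r = follows nm h' i n r"
proof -
  have "view h i t = view h' i t" if "t < n" for t
    using that by (intro view_cong assms(2)) auto
  with assms(1) show ?thesis by (auto simp: follows_def)
qed

text \<open>A party may be one round ahead of another one, because a message of round \<^term>\<open>t\<close> depends
  only on the rounds before \<^term>\<open>t\<close>.\<close>
lemma msgs_eq_iff_follows:
  assumes n: "\<And>i j. n i \<le> Suc (n j)"
  shows "(\<forall>i j t. i \<noteq> j \<longrightarrow> t < n i \<longrightarrow> msg nm r t i j = h t i j) \<longleftrightarrow> (\<forall>i. follows nm h i (n i) (r i))"
    (is "?L \<longleftrightarrow> ?R")
proof
  assume L: ?L
  show ?R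
    unfolding follows_def
  proof (intro allI impI)
    fix i t j assume t: "t < n i" and j: "j \<noteq> i"
    have "view (msg nm r) i t = view h i t"
    proof (rule view_cong)
      fix s k assume "s < t" "k \<noteq> i"
      with t n[of i k] have "s < n k" by simp
      with L \<open>k \<noteq> i\<close> show "msg nm r s k i = h s k i" by blast
    qed
    with L t j msg_eq_view[of i j nm r t] show "nm i j t (r i) (view h i t) = h t i j" by auto
  qed
next
  assume R: ?R
  have "\<forall>i j. i \<noteq> j \<longrightarrow> t < n i \<longrightarrow> msg nm r t i j = h t i j" for t
  proof (induction t rule: less_induct)
    case (less t)
    show ?case
    proof (intro allI impI)
      fix i j assume ij: "i \<noteq> j" and t: "t < n i"
      have "view (msg nm r) i t = view h i t"
      proof (rule view_cong)
        fix s k assume "s < t" "k \<noteq> i"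
        with t n[of i k] have "s < n k" by simp
        with less \<open>s < t\<close> \<open>k \<noteq> i\<close> show "msg nm r s k i = h s k i" by blast
      qed
      moreover have "nm i j t (r i) (view h i t) = h t i j"
        using R t ij unfolding follows_def by metis
      ultimately show "msg nm r t i j = h t i j"
        by (simp add: msg_eq_view[OF ij])
    qed
  qed
  then show ?L by blast
qed

text \<open>Each sender a has its own clock \<open>n a\<close>, so a round can be interrupted
  between two senders. A function padded with None, unlike a list, is symmetric in the two
  ends.\<close>

definition lnk :: "('w \<Rightarrow> nat \<Rightarrow> party \<Rightarrow> party \<Rightarrow> 'm option) \<Rightarrow> (party \<Rightarrow> nat) \<Rightarrow> party \<Rightarrow> party
    \<Rightarrow> 'w \<Rightarrow> nat \<Rightarrow> party \<Rightarrow> party \<Rightarrow> 'm option" where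
  "lnk H n i j w = (\<lambda>t a b. if (a = i \<and> b = j \<or> a = j \<and> b = i) \<and> t < n a then H w t a b else None)"

lemma lnk_commute: "lnk H n i j = lnk H n j i"
  by (auto simp: lnk_def fun_eq_iff)

lemma lnk_eq_iff:
  "lnk H n i j v = lnk H n i j w \<longleftrightarrow> (\<forall>t. (t < n i \<longrightarrow> H v t i j = H w t i j) \<and> (t < n j \<longrightarrow> H v t j i = H w t j i))"
  by (auto simp: lnk_def fun_eq_iff)

lemma determines_lnk_mono:
  assumes "\<And>a. n a \<le> n' a"
  shows "determines q (lnk H n' i j) (lnk H n i j)"
  using assms by (auto intro!: determinesI simp: lnk_eq_iff) (meson less_le_trans)+

text \<open>What remains of the independent randomness: histories have product probabilities, and
  the factor of i sees what i sends in rounds t < n but only what it receives in rounds with Suc t <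
  n. This shift is the delay of synchronous communication, and it permits clocks that differ by
  one.\<close>

locale message_law =
  fixes q :: "'w pmf" and H :: "'w \<Rightarrow> nat \<Rightarrow> party \<Rightarrow> party \<Rightarrow> 'm option"
    and \<Phi> :: "party \<Rightarrow> nat \<Rightarrow> (nat \<Rightarrow> party \<Rightarrow> party \<Rightarrow> 'm option) \<Rightarrow> real"
  assumes prob_msgs: "\<And>n h. (\<And>i j. n i \<le> Suc (n j)) \<Longrightarrow>
      measure_pmf.prob q {w. \<forall>i j t. i \<noteq> j \<longrightarrow> t < n i \<longrightarrow> H w t i j = h t i j} = (\<Prod>i\<in>UNIV. \<Phi> i (n i) h)"
    and \<Phi>_cong: "\<And>i n h h'. (\<And>t j. t < n \<Longrightarrow> j \<noteq> i \<Longrightarrow> h t i j = h' t i j) \<Longrightarrow>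
      (\<And>t k. Suc t < n \<Longrightarrow> k \<noteq> i \<Longrightarrow> h t k i = h' t k i) \<Longrightarrow> \<Phi> i n h = \<Phi> i n h'"
    and \<Phi>_nonneg: "\<And>i n h. \<Phi> i n h \<ge> 0"
begin

text \<open>Cut and paste: a history of party \<^term>\<open>i\<close> and a history of the other two parties that agree
  on the links of \<^term>\<open>i\<close> combine into one history, whose probability factorizes.\<close>
lemma cond_indep_step:
  assumes ijk: "UNIV = {i, j, k}" "i \<noteq> j" "i \<noteq> k" "j \<noteq> k"
    and n: "\<And>a. n i \<le> n a" "\<And>a. n a \<le> Suc (n i)" and n': "n' = n(i := Suc (n i))"
  shows "cond_indep q (\<lambda>w. (lnk H n' i j w, lnk H n' i k w)) (\<lambda>w. (lnk H n i j w, lnk H n i k w)) (lnk H n j k)"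
proof (rule cond_indep_glueI)
  fix v w
  assume "(lnk H n i j v, lnk H n i k v) = (lnk H n i j w, lnk H n i k w)"
  then have vw: "t < n i \<Longrightarrow> H v t i j = H w t i j" "t < n j \<Longrightarrow> H v t j i = H w t j i"
     "t < n i \<Longrightarrow> H v t i k = H w t i k" "t < n k \<Longrightarrow> H v t k i = H w t k i" for t
    by (auto simp: lnk_eq_iff)
  \<comment> \<open>The hybrid history: party i speaks as in v, the other two as in w.\<close>
  define h where "h = (\<lambda>t a b. if a = i then H v t a b else H w t a b)"
  have n'_le: "n' a \<le> Suc (n' b)" for a b
    using n(1)[of b] n(2)[of a] n' by (auto split: if_splits)
  have all: "(\<forall>a b t. a \<noteq> b \<longrightarrow> t < n' a \<longrightarrow> H x t a b = h t a b) \<longleftrightarrow>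
     (\<forall>t. (t < n' i \<longrightarrow> H x t i j = H v t i j \<and> H x t i k = H v t i k) \<and>
       (t < n j \<longrightarrow> H x t j i = H w t j i \<and> H x t j k = H w t j k) \<and>
       (t < n k \<longrightarrow> H x t k i = H w t k i \<and> H x t k j = H w t k j))" for x
  proof -
    have ex: "(\<forall>a. P a) \<longleftrightarrow> P i \<and> P j \<and> P k" for P
      using ijk(1) by (metis UNIV_I insertE singletonD)
    show ?thesis
      unfolding ex[of "\<lambda>a. \<forall>b t. a \<noteq> b \<longrightarrow> t < n' a \<longrightarrow> H x t a b = h t a b"]
      unfolding ex[of "\<lambda>b. \<forall>t. c \<noteq> b \<longrightarrow> t < n' c \<longrightarrow> H x t c b = h t c b" for c]
      using ijk(2-4) by (auto simp: h_def n')
  qed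
  have "{x. (lnk H n' i j x, lnk H n' i k x) = (lnk H n' i j v, lnk H n' i k v) \<and>
        (lnk H n i j x, lnk H n i k x) = (lnk H n i j v, lnk H n i k v) \<and> lnk H n j k x = lnk H n j k w}
      = {x. \<forall>a b t. a \<noteq> b \<longrightarrow> t < n' a \<longrightarrow> H x t a b = h t a b}"
    unfolding all using ijk(2-4) vw by (auto simp: lnk_eq_iff n' less_Suc_eq)
  then have "measure_pmf.prob q {x. (lnk H n' i j x, lnk H n' i k x) = (lnk H n' i j v, lnk H n' i k v) \<and>
        (lnk H n i j x, lnk H n i k x) = (lnk H n i j v, lnk H n i k v) \<and> lnk H n j k x = lnk H n j k w}
      = (\<Prod>a\<in>UNIV. \<Phi> a (n' a) h)"
    using prob_msgs[of n' h] n'_le by simp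
  also have "\<dots> = \<Phi> i (n' i) h * (\<Phi> j (n' j) h * \<Phi> k (n' k) h)"
    unfolding ijk(1) using ijk(2-4) by simp
  also have "\<Phi> i (n' i) h = \<Phi> i (n' i) (H v)"
  proof (rule \<Phi>_cong)
    fix t a assume t: "Suc t < n' i" "a \<noteq> i"
    then have "t < n i" by (simp add: n')
    then have "t < n j" "t < n k" using n(1)[of j] n(1)[of k] by auto
    moreover have "a = j \<or> a = k" using t(2) ijk(1) by blast
    ultimately show "h t a i = H v t a i"
      using vw[of t] t(2) by (auto simp: h_def)
  qed (simp add: h_def)
  \<comment> \<open>The factor of j sees messages of i only in rounds t with Suc t < n j, hence t <
    n i. There v and w agree, and the new message of i is not among them.\<close>
  also have "\<Phi> j (n' j) h = \<Phi> j (n j) (H w)"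
  proof -
    have "\<Phi> j (n j) h = \<Phi> j (n j) (H w)"
    proof (rule \<Phi>_cong)
      fix t a assume t: "Suc t < n j" "a \<noteq> j"
      then have "t < n i" using n(2)[of j] by simp
      with vw[of t] show "h t a j = H w t a j" by (simp add: h_def)
    qed (use ijk in \<open>simp add: h_def\<close>)
    then show ?thesis using ijk by (simp add: n')
  qed
  also have "\<Phi> k (n' k) h = \<Phi> k (n k) (H w)"
  proof -
    have "\<Phi> k (n k) h = \<Phi> k (n k) (H w)"
    proof (rule \<Phi>_cong)
      fix t a assume t: "Suc t < n k" "a \<noteq> k"
      then have "t < n i" using n(2)[of k] by simp
      with vw[of t] show "h t a k = H w t a k" by (simp add: h_def)
    qed (use ijk in \<open>simp add: h_def\<close>)
    then show ?thesis using ijk by (simp add: n')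
  qed
  finally show "measure_pmf.prob q {x. (lnk H n' i j x, lnk H n' i k x) = (lnk H n' i j v, lnk H n' i k v) \<and>
        (lnk H n i j x, lnk H n i k x) = (lnk H n i j v, lnk H n i k v) \<and> lnk H n j k x = lnk H n j k w}
      = \<Phi> i (n' i) (H v) * (\<Phi> j (n j) (H w) * \<Phi> k (n k) (H w))" .
qed (simp_all add: \<Phi>_nonneg)

text \<open>One round is played as three sends. Party i extends the two sides, j extends one side
  and the target, and k does the same on the other side, with the sides exchanged by
  symmetry.\<close>

lemma coinfo_nonneg_lnk:
  assumes ijk: "UNIV = {i, j, k}" "i \<noteq> j" "i \<noteq> k" "j \<noteq> k"
    and fin: "\<And>n. fin_ent q (lnk H n j k)"
  shows "coinfo_nonneg q (lnk H (\<lambda>_. T) i j) (lnk H (\<lambda>_. T) i k) (lnk H (\<lambda>_. T) j k)"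
proof (induction T)
  case 0
  have "lnk H (\<lambda>_. 0) j k = (\<lambda>_ _ _ _. None)"
    by (simp add: lnk_def fun_eq_iff)
  then show ?case by (simp add: coinfo_nonneg_const)
next
  case (Suc T)
  let ?n0 = "\<lambda>_::party. T"
  let ?n1 = "?n0(i := Suc T)"
  let ?n2 = "?n1(j := Suc T)"
  let ?n3 = "?n2(k := Suc T)"
  have jik: "UNIV = {j, i, k}" and kij: "UNIV = {k, i, j}" using ijk by auto
  have n3: "?n3 = (\<lambda>_. Suc T)"
    using ijk(1) by (auto simp: fun_eq_iff)
  have "coinfo_nonneg q (lnk H ?n1 i j) (lnk H ?n1 i k) (lnk H ?n0 j k)"
    by (rule coinfo_nonneg_opposite_step[OF Suc fin cond_indep_step[OF ijk]])
      (auto intro!: determines_lnk_mono)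
  moreover have "lnk H ?n1 j k = lnk H ?n0 j k"
    using ijk(2-4) by (auto simp: lnk_def fun_eq_iff)
  ultimately have 1: "coinfo_nonneg q (lnk H ?n1 i j) (lnk H ?n1 i k) (lnk H ?n1 j k)"
    by simp
  have "coinfo_nonneg q (lnk H ?n2 i j) (lnk H ?n1 i k) (lnk H ?n2 j k)"
  proof (rule coinfo_nonneg_adjacent_step[OF 1 fin])
    show "cond_indep q (\<lambda>w. (lnk H ?n2 i j w, lnk H ?n2 j k w)) (\<lambda>w. (lnk H ?n1 i j w, lnk H ?n1 j k w)) (lnk H ?n1 i k)"
      using cond_indep_step[OF jik, of ?n1 ?n2] ijk(2-4) by (simp add: lnk_commute[of H _ j i])
  qed (auto intro!: determines_lnk_mono)
  moreover have "lnk H ?n2 i k = lnk H ?n1 i k"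
    using ijk(2-4) by (auto simp: lnk_def fun_eq_iff)
  ultimately have 2: "coinfo_nonneg q (lnk H ?n2 i k) (lnk H ?n2 i j) (lnk H ?n2 j k)"
    by (simp add: coinfo_nonneg_commute)
  have "coinfo_nonneg q (lnk H ?n3 i k) (lnk H ?n2 i j) (lnk H ?n3 j k)"
  proof (rule coinfo_nonneg_adjacent_step[OF 2 fin])
    show "cond_indep q (\<lambda>w. (lnk H ?n3 i k w, lnk H ?n3 j k w)) (\<lambda>w. (lnk H ?n2 i k w, lnk H ?n2 j k w)) (lnk H ?n2 i j)"
      using cond_indep_step[OF kij, of ?n2 ?n3] ijk(2-4)
      by (simp add: lnk_commute[of H _ k i] lnk_commute[of H _ k j])
  qed (auto intro!: determines_lnk_mono)
  moreover have "lnk H ?n3 i j = lnk H ?n2 i j"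
    using ijk(2-4) by (auto simp: lnk_def fun_eq_iff)
  ultimately have "coinfo_nonneg q (lnk H ?n3 i j) (lnk H ?n3 i k) (lnk H ?n3 j k)"
    by (simp add: coinfo_nonneg_commute)
  then show ?case unfolding n3 .
qed

end

subsection \<open>The law of the transcripts\<close>

definition pad :: "('m option \<times> 'm option) list \<Rightarrow> nat \<Rightarrow> 'm option \<times> 'm option" where
  "pad l t = (if t < length l then l ! t else (None, None))"

text \<open>The image of \<open>trunc\<close>: between eventually silent sequences and these lists,
  \<open>trunc\<close> and \<open>pad\<close> are mutually inverse, so a transcript loses no
  message.\<close>

definition trimmed :: "('m option \<times> 'm option) list \<Rightarrow> bool" where
  "trimmed l \<longleftrightarrow> l = [] \<or> last l \<noteq> (None, None)"

lemma
  assumes "\<exists>N. \<forall>t\<ge>N. s t = (None, None)"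
  shows pad_trunc: "pad (trunc s) = s" and trimmed_trunc: "trimmed (trunc s)"
proof -
  define L where "L = (LEAST N. \<forall>t\<ge>N. s t = (None, None))"
  have tr: "trunc s = map s [0..<L]"
    using assms by (simp add: trunc_def L_def)
  have L: "\<forall>t\<ge>L. s t = (None, None)"
    unfolding L_def using assms by (rule LeastI_ex)
  show "pad (trunc s) = s"
    using L by (auto simp: tr pad_def fun_eq_iff)
  show "trimmed (trunc s)"
  proof (cases L)
    case 0
    then show ?thesis by (simp add: tr trimmed_def)
  next
    case (Suc K)
    have "s K \<noteq> (None, None)"
    proof
      assume K: "s K = (None, None)"
      have "\<forall>t\<ge>K. s t = (None, None)"
      proof (intro allI impI)
        fix t assume "t \<ge> K"
        then show "s t = (None, None)"
          using K L Suc by (cases "t = K") auto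
      qed
      then have "L \<le> K" unfolding L_def by (rule Least_le)
      with Suc show False by simp
    qed
    with Suc show ?thesis by (simp add: tr trimmed_def last_map)
  qed
qed

lemma eventually_pad: "\<exists>N. \<forall>t\<ge>N. pad l t = (None, None)"
  by (rule exI[of _ "length l"]) (simp add: pad_def)

lemma trunc_pad:
  assumes "trimmed l"
  shows "trunc (pad l) = l"
proof -
  define L where "L = (LEAST N. \<forall>t\<ge>N. pad l t = (None, None))"
  have L: "\<forall>t\<ge>L. pad l t = (None, None)"
    unfolding L_def using eventually_pad by (rule LeastI_ex)
  have "L \<le> length l"
    unfolding L_def by (rule Least_le) (simp add: pad_def)
  moreover have "\<not> L < length l"
  proof
    assume "L < length l"
    then have "pad l (length l - 1) = (None, None)" "l \<noteq> []" using L by auto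
    with assms show False
      by (auto simp: pad_def trimmed_def last_conv_nth)
  qed
  ultimately have "L = length l" by simp
  moreover have "trunc (pad l) = map (pad l) [0..<L]"
    using eventually_pad[of l] by (simp add: trunc_def L_def)
  ultimately show ?thesis
    by (auto intro!: nth_equalityI simp: pad_def)
qed

text \<open>This describes the preimage of a list by countably many conditions on single rounds,
  which gives measurability. Sequences that never fall silent go to the default [].\<close>

lemma trunc_eq_iff:
  "trunc s = l \<longleftrightarrow> (if \<exists>N. \<forall>t\<ge>N. s t = (None, None) then trimmed l \<and> (\<forall>t. s t = pad l t) else l = [])"
proof (cases "\<exists>N. \<forall>t\<ge>N. s t = (None, None)")
  case True
  have "trunc s = l \<longleftrightarrow> trimmed l \<and> s = pad l"
    using pad_trunc[OF True] trimmed_trunc[OF True] trunc_pad by metis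
  with True show ?thesis by (simp add: fun_eq_iff)
next
  case False
  then show ?thesis by (auto simp: trunc_def)
qed

text \<open>The arguments are the links 12, 23 and 31 in this order. The last is oriented from
  Charlie to Alice, so its first components are the messages of Charlie.\<close>

fun msgs_of :: "('m option \<times> 'm option) list \<Rightarrow> ('m option \<times> 'm option) list \<Rightarrow> ('m option \<times> 'm option) list
    \<Rightarrow> nat \<Rightarrow> party \<Rightarrow> party \<Rightarrow> 'm option" where
  "msgs_of b d c t PA PB = fst (pad b t)"
| "msgs_of b d c t PB PA = snd (pad b t)"
| "msgs_of b d c t PB PC = fst (pad d t)"
| "msgs_of b d c t PC PB = snd (pad d t)"
| "msgs_of b d c t PC PA = fst (pad c t)"
| "msgs_of b d c t PA PC = snd (pad c t)"
| "msgs_of b d c t _ _ = None"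

section \<open>Measurability and laws of countably valued variables\<close>

lemma measurable_Pair_count_space:
  fixes f :: "'w \<Rightarrow> 'a::countable" and g :: "'w \<Rightarrow> 'b::countable"
  assumes "f \<in> measurable M (count_space UNIV)" "g \<in> measurable M (count_space UNIV)"
  shows "(\<lambda>x. (f x, g x)) \<in> measurable M (count_space UNIV)"
  by (rule measurable_compose_countable[OF _ assms(1)], rule measurable_compose[OF assms(2)]) simp

lemma measurable_fun_count_space:
  fixes f :: "'w \<Rightarrow> 'i::finite \<Rightarrow> 'j::finite \<Rightarrow> 'a::countable"
  assumes [measurable]: "\<And>i j. (\<lambda>x. f x i j) \<in> measurable M (count_space UNIV)"
  shows "f \<in> measurable M (count_space UNIV)"
  unfolding measurable_count_space_eq_countable[OF countableI_type]
proof (intro conjI ballI)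
  fix a
  have "f -` {a} \<inter> space M = {x\<in>space M. \<forall>i j. f x i j = a i j}"
    by (auto simp: fun_eq_iff)
  also have "\<dots> \<in> sets M" by measurable
  finally show "f -` {a} \<inter> space M \<in> sets M" .
qed simp

text \<open>With countably many values the law is carried by atoms; this is the passage from M to
  the discrete setting.\<close>

lemma (in prob_space) ex_law_pmf:
  fixes W :: "'a \<Rightarrow> 'c::countable"
  assumes W: "W \<in> measurable M (count_space UNIV)"
  shows "\<exists>q. \<forall>P. measure_pmf.prob q {w. P w} = prob {x\<in>space M. P (W x)}"
proof -
  let ?N = "distr M (count_space UNIV) W"
  interpret N: prob_space ?N by (rule prob_space_distr[OF W])
  have s: "sets ?N = UNIV" by simp
  have "AE x in ?N. measure ?N {x} \<noteq> 0"
    unfolding N.AE_support_countable[OF s] by (rule exI[of _ UNIV]) simp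
  then have "measure_pmf (Abs_pmf ?N) = ?N"
    by (intro Abs_pmf_inverse) (simp add: N.prob_space_axioms s)
  then have "measure_pmf.prob (Abs_pmf ?N) {w. P w} = prob {x\<in>space M. P (W x)}" for P
    by (simp add: measure_distr[OF W] vimage_def Int_def conj_commute)
  then show ?thesis by blast
qed

type_synonym ('m, 'x, 'y, 'z) outcome =
  "('m option \<times> 'm option) list \<times> ('m option \<times> 'm option) list \<times> ('m option \<times> 'm option) list \<times> 'x \<times> 'y \<times> 'z"

locale protocol_run = prob_space M for M :: "'w measure" +
  fixes S :: "party \<Rightarrow> 'r measure" and R :: "party \<Rightarrow> 'w \<Rightarrow> 'r"
    and nm :: "party \<Rightarrow> party \<Rightarrow> nat \<Rightarrow> 'r \<Rightarrow> (party \<Rightarrow> 'm::countable option) list \<Rightarrow> 'm option"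
    and oA :: "'r \<Rightarrow> ('m option \<times> 'm option) list \<Rightarrow> ('m option \<times> 'm option) list \<Rightarrow> 'x::finite"
    and oB :: "'r \<Rightarrow> ('m option \<times> 'm option) list \<Rightarrow> ('m option \<times> 'm option) list \<Rightarrow> 'y::finite"
    and oC :: "'r \<Rightarrow> ('m option \<times> 'm option) list \<Rightarrow> ('m option \<times> 'm option) list \<Rightarrow> 'z::finite"
  assumes indep: "indep_vars S R UNIV"
    and nm [measurable]: "\<And>i j t v. (\<lambda>r. nm i j t r v) \<in> measurable (S i) (count_space UNIV)"
    and oA [measurable]: "\<And>a b. (\<lambda>r. oA r a b) \<in> measurable (S PA) (count_space UNIV)"
    and oB [measurable]: "\<And>a b. (\<lambda>r. oB r a b) \<in> measurable (S PB) (count_space UNIV)"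
    and oC [measurable]: "\<And>a b. (\<lambda>r. oC r a b) \<in> measurable (S PC) (count_space UNIV)"
    and terminates: "AE \<omega> in M. \<exists>N. \<forall>t\<ge>N. \<forall>i j. msg nm (\<lambda>k. R k \<omega>) t i j = None"
begin

lemma R_measurable [measurable]: "R i \<in> measurable M (S i)"
  using indep by (simp add: indep_vars_def)

lemma follows_pred [measurable]: "Measurable.pred (S i) (follows nm h i n)"
  unfolding follows_def by measurable

lemma prob_all_parties:
  assumes "\<And>i. Measurable.pred (S i) (P i)"
  shows "prob {\<omega>\<in>space M. \<forall>i. P i (R i \<omega>)} = (\<Prod>i\<in>UNIV. prob {\<omega>\<in>space M. P i (R i \<omega>)})"
proof -
  have "indep_events (\<lambda>i. {x\<in>space M. P i (R i x)}) UNIV"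
    by (rule indep_eventsI_indep_vars[OF indep]) (use assms in \<open>auto simp: pred_def\<close>)
  then have "prob (\<Inter>i\<in>UNIV. {x\<in>space M. P i (R i x)}) = (\<Prod>i\<in>UNIV. prob {\<omega>\<in>space M. P i (R i \<omega>)})"
    unfolding indep_events_def by simp
  moreover have "(\<Inter>i\<in>UNIV. {x\<in>space M. P i (R i x)}) = {\<omega>\<in>space M. \<forall>i. P i (R i \<omega>)}"
    by auto
  ultimately show ?thesis by simp
qed

lemma hist_measurable: "(\<lambda>\<omega>. hist nm (\<lambda>k. R k \<omega>) t) \<in> measurable M (count_space UNIV)"
proof (induction t)
  case (Suc t)
  have "(\<lambda>\<omega>. v @ [\<lambda>i j. if i = j then None else nm i j t (R i \<omega>) (map (\<lambda>rd k. rd k i) v)])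
      \<in> measurable M (count_space UNIV)" for v
  proof (rule measurable_compose[of _ M "count_space UNIV" "\<lambda>g. v @ [g]"])
    show "(\<lambda>\<omega> i j. if i = j then None else nm i j t (R i \<omega>) (map (\<lambda>rd k. rd k i) v))
        \<in> measurable M (count_space UNIV)"
    proof (rule measurable_fun_count_space)
      fix i j
      show "(\<lambda>\<omega>. if i = j then None else nm i j t (R i \<omega>) (map (\<lambda>rd k. rd k i) v)) \<in> measurable M (count_space UNIV)"
        by (cases "i = j") simp_all
    qed
  qed simp
  from measurable_compose_countable[OF this Suc] show ?case by simp
qed simp

lemma msg_measurable [measurable]:
  "(\<lambda>\<omega>. msg nm (\<lambda>k. R k \<omega>) t i j) \<in> measurable M (count_space UNIV)"
  unfolding msg_def
  by (rule measurable_compose[OF hist_measurable, of "\<lambda>h. (h ! t) i j"]) simp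

lemma link_measurable [measurable]:
  "(\<lambda>\<omega>. link nm (\<lambda>k. R k \<omega>) i j) \<in> measurable M (count_space UNIV)"
  unfolding measurable_count_space_eq_countable[OF countableI_type]
proof (intro conjI ballI)
  fix l :: "('m option \<times> 'm option) list"
  let ?s = "\<lambda>\<omega> t. (msg nm (\<lambda>k. R k \<omega>) t i j, msg nm (\<lambda>k. R k \<omega>) t j i)"
  have [measurable]: "(\<lambda>\<omega>. ?s \<omega> t) \<in> measurable M (count_space UNIV)" for t
    by (intro measurable_Pair_count_space msg_measurable)
  have "(\<lambda>\<omega>. link nm (\<lambda>k. R k \<omega>) i j) -` {l} \<inter> space M
     = {\<omega>\<in>space M. if \<exists>N. \<forall>t\<ge>N. ?s \<omega> t = (None, None) then trimmed l \<and> (\<forall>t. ?s \<omega> t = pad l t) else l = []}"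
    unfolding link_def trunc_eq_iff[symmetric] by auto
  also have "\<dots> \<in> sets M" by measurable
  finally show "(\<lambda>\<omega>. link nm (\<lambda>k. R k \<omega>) i j) -` {l} \<inter> space M \<in> sets M" .
qed simp

definition W where
  "W \<omega> = (M12 R nm \<omega>, M23 R nm \<omega>, M31 R nm \<omega>, outX R nm oA \<omega>, outY R nm oB \<omega>, outZ R nm oC \<omega>)"

lemma W_measurable [measurable]: "W \<in> measurable M (count_space UNIV)"
proof -
  have l [measurable]: "M12 R nm \<in> measurable M (count_space UNIV)" "M23 R nm \<in> measurable M (count_space UNIV)"
    "M31 R nm \<in> measurable M (count_space UNIV)"
    unfolding M12_def M23_def M31_def by measurable
  have "outX R nm oA \<in> measurable M (count_space UNIV)"
    unfolding outX_def
    by (rule measurable_compose_countable[OF measurable_compose_countable[OF _ l(1)] l(3), of "\<lambda>c b \<omega>. oA (R PA \<omega>) b c"])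
      measurable
  moreover have "outY R nm oB \<in> measurable M (count_space UNIV)"
    unfolding outY_def
    by (rule measurable_compose_countable[OF measurable_compose_countable[OF _ l(1)] l(2), of "\<lambda>c b \<omega>. oB (R PB \<omega>) b c"])
      measurable
  moreover have "outZ R nm oC \<in> measurable M (count_space UNIV)"
    unfolding outZ_def
    by (rule measurable_compose_countable[OF measurable_compose_countable[OF _ l(2)] l(3), of "\<lambda>c b \<omega>. oC (R PC \<omega>) b c"])
      measurable
  ultimately show ?thesis
    unfolding W_def using l by (intro measurable_Pair_count_space)
qed

definition q where "q = (SOME q. \<forall>P. measure_pmf.prob q {w. P w} = prob {\<omega>\<in>space M. P (W \<omega>)})"

lemma prob_q: "measure_pmf.prob q {w. P w} = prob {\<omega>\<in>space M. P (W \<omega>)}"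
proof -
  have "\<forall>P. measure_pmf.prob q {w. P w} = prob {\<omega>\<in>space M. P (W \<omega>)}"
    unfolding q_def by (rule someI_ex[OF ex_law_pmf[OF W_measurable]])
  then show ?thesis by blast
qed

lemma prob_q_AE:
  assumes "AE \<omega> in M. P (W \<omega>) \<longleftrightarrow> Q \<omega>" "Measurable.pred M Q"
  shows "measure_pmf.prob q {w. P w} = prob {\<omega>\<in>space M. Q \<omega>}"
proof -
  have "Measurable.pred M (\<lambda>\<omega>. P (W \<omega>))"
    by (rule measurable_compose[OF W_measurable]) simp
  then show ?thesis
    unfolding prob_q using assms by (intro finite_measure_eq_AE) (auto simp: pred_def)
qed

definition w12 where "w12 w = fst w" for w :: "('m, 'x, 'y, 'z) outcome"
definition w23 where "w23 w = fst (snd w)" for w :: "('m, 'x, 'y, 'z) outcome"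
definition w31 where "w31 w = fst (snd (snd w))" for w :: "('m, 'x, 'y, 'z) outcome"
definition X where "X w = fst (snd (snd (snd w)))" for w :: "('m, 'x, 'y, 'z) outcome"
definition Y where "Y w = fst (snd (snd (snd (snd w))))" for w :: "('m, 'x, 'y, 'z) outcome"
definition Z where "Z w = snd (snd (snd (snd (snd w))))" for w :: "('m, 'x, 'y, 'z) outcome"

lemmas proj_defs = w12_def w23_def w31_def X_def Y_def Z_def

definition H where "H w = msgs_of (w12 w) (w23 w) (w31 w)"

lemma proj_W [simp]:
  "w12 (W \<omega>) = M12 R nm \<omega>" "w23 (W \<omega>) = M23 R nm \<omega>" "w31 (W \<omega>) = M31 R nm \<omega>"
  "X (W \<omega>) = outX R nm oA \<omega>" "Y (W \<omega>) = outY R nm oB \<omega>" "Z (W \<omega>) = outZ R nm oC \<omega>"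
  by (simp_all add: W_def proj_defs)

lemma AE_transcripts:
  "AE \<omega> in M. H (W \<omega>) = msg nm (\<lambda>k. R k \<omega>) \<and> trimmed (M12 R nm \<omega>) \<and> trimmed (M23 R nm \<omega>) \<and> trimmed (M31 R nm \<omega>)"
  using terminates
proof eventually_elim
  case (elim \<omega>)
  let ?m = "msg nm (\<lambda>k. R k \<omega>)"
  from elim have ex: "\<exists>N. \<forall>t\<ge>N. (?m t i j, ?m t j i) = (None, None)" for i j
    by blast
  have "H (W \<omega>) t a b = ?m t a b" for t a b
    by (cases a; cases b) (simp_all add: H_def M12_def M23_def M31_def link_def pad_trunc[OF ex])
  then show ?case
    by (simp add: fun_eq_iff M12_def M23_def M31_def link_def trimmed_trunc[OF ex])
qed

lemma trimmed_supp:
  assumes "w \<in> set_pmf q"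
  shows "trimmed (w12 w)" "trimmed (w23 w)" "trimmed (w31 w)"
proof -
  let ?P = "\<lambda>w. \<not> (trimmed (w12 w) \<and> trimmed (w23 w) \<and> trimmed (w31 w))"
  have "measure_pmf.prob q {w. ?P w} = prob {\<omega>\<in>space M. False}"
    by (rule prob_q_AE) (use AE_transcripts in auto)
  then have "measure_pmf.prob q {w. ?P w} = 0" by simp
  then have "\<not> ?P w"
    using measure_pmf_posI[OF assms, of "{w. ?P w}"] by auto
  then show "trimmed (w12 w)" "trimmed (w23 w)" "trimmed (w31 w)" by auto
qed

text \<open>The factor of a party is the probability that its randomness follows the history;
  independence turns the conjunction over parties into the product.\<close>

sublocale message_law q H "\<lambda>i n h. prob {\<omega>\<in>space M. follows nm h i n (R i \<omega>)}"
proof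
  fix n :: "party \<Rightarrow> nat" and h assume n: "\<And>i j. n i \<le> Suc (n j)"
  have "measure_pmf.prob q {w. \<forall>i j t. i \<noteq> j \<longrightarrow> t < n i \<longrightarrow> H w t i j = h t i j}
      = prob {\<omega>\<in>space M. \<forall>i. follows nm h i (n i) (R i \<omega>)}"
  proof (rule prob_q_AE)
    show "AE \<omega> in M. (\<forall>i j t. i \<noteq> j \<longrightarrow> t < n i \<longrightarrow> H (W \<omega>) t i j = h t i j) = (\<forall>i. follows nm h i (n i) (R i \<omega>))"
      using AE_transcripts by eventually_elim (simp add: msgs_eq_iff_follows[OF n, symmetric])
    show "Measurable.pred M (\<lambda>\<omega>. \<forall>i. follows nm h i (n i) (R i \<omega>))"
      by measurable
  qed
  also have "\<dots> = (\<Prod>i\<in>UNIV. prob {\<omega>\<in>space M. follows nm h i (n i) (R i \<omega>)})"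
    by (rule prob_all_parties) simp
  finally show "measure_pmf.prob q {w. \<forall>i j t. i \<noteq> j \<longrightarrow> t < n i \<longrightarrow> H w t i j = h t i j}
      = (\<Prod>i\<in>UNIV. prob {\<omega>\<in>space M. follows nm h i (n i) (R i \<omega>)})" .
next
  fix i n and h h' :: "nat \<Rightarrow> party \<Rightarrow> party \<Rightarrow> 'm option"
  assume "\<And>t j. t < n \<Longrightarrow> j \<noteq> i \<Longrightarrow> h t i j = h' t i j" "\<And>t k. Suc t < n \<Longrightarrow> k \<noteq> i \<Longrightarrow> h t k i = h' t k i"
  with follows_cong[of n i h h' nm] show "prob {\<omega>\<in>space M. follows nm h i n (R i \<omega>)} = prob {\<omega>\<in>space M. follows nm h' i n (R i \<omega>)}"
    by simp
qed simp

text \<open>Given transcripts occur exactly when each party follows its own two links forever, and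
  its output depends on its randomness and the same links. Each party thus contributes a factor that
  does not see the opposite link.\<close>

lemma prob_q_outputs:
  obtains \<alpha> \<beta> \<gamma> where
    "\<And>b d c x y z. measure_pmf.prob q {w. w12 w = b \<and> w23 w = d \<and> w31 w = c \<and> X w = x \<and> Y w = y \<and> Z w = z}
      = \<alpha> b c x * \<beta> b d y * \<gamma> d c z"
    "\<And>b c x. \<alpha> b c x \<ge> 0" "\<And>b d y. \<beta> b d y \<ge> 0" "\<And>d c z. \<gamma> d c z \<ge> (0::real)"
proof -
  define F where "F h i r \<longleftrightarrow> (\<forall>n. follows nm h i n r)" for h i r
  have F [measurable]: "Measurable.pred (S i) (F h i)" for h i
    unfolding F_def by measurable
  have F_cong: "F h i r = F h' i r"
    if "\<And>t j. j \<noteq> i \<Longrightarrow> h t i j = h' t i j" "\<And>t k. k \<noteq> i \<Longrightarrow> h t k i = h' t k i" for h h' i r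
    unfolding F_def using follows_cong[of _ i h h' nm r] that by simp
  \<comment> \<open>The opposite link is replaced by [], which Alice cannot notice and which makes
    the factor independent of d. The \<open>trimmed\<close> conditions give probability 0 to lists
    that are no transcripts.\<close>
  define \<alpha> where "\<alpha> b c x = prob {\<omega>\<in>space M. trimmed b \<and> trimmed c \<and> F (msgs_of b [] c) PA (R PA \<omega>) \<and> oA (R PA \<omega>) b c = x}" for b c x
  define \<beta> where "\<beta> b d y = prob {\<omega>\<in>space M. trimmed b \<and> trimmed d \<and> F (msgs_of b d []) PB (R PB \<omega>) \<and> oB (R PB \<omega>) b d = y}" for b d y
  define \<gamma> where "\<gamma> d c z = prob {\<omega>\<in>space M. trimmed d \<and> trimmed c \<and> F (msgs_of [] d c) PC (R PC \<omega>) \<and> oC (R PC \<omega>) d c = z}" for d c z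
  show thesis
  proof (rule that)
    show "\<And>b c x. \<alpha> b c x \<ge> 0" "\<And>b d y. \<beta> b d y \<ge> 0" "\<And>d c z. \<gamma> d c z \<ge> 0"
      by (simp_all add: \<alpha>_def \<beta>_def \<gamma>_def)
    fix b d c :: "('m option \<times> 'm option) list" and x y z
    let ?h = "msgs_of b d c"
    define P where "P i r \<longleftrightarrow> (case i of
        PA \<Rightarrow> trimmed b \<and> trimmed c \<and> F (msgs_of b [] c) PA r \<and> oA r b c = x
      | PB \<Rightarrow> trimmed b \<and> trimmed d \<and> F (msgs_of b d []) PB r \<and> oB r b d = y
      | PC \<Rightarrow> trimmed d \<and> trimmed c \<and> F (msgs_of [] d c) PC r \<and> oC r d c = z)" for i r
    have P_meas [measurable]: "Measurable.pred (S i) (P i)" for i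
    proof (cases i)
      case PA
      show ?thesis unfolding PA P_def party.case by measurable
    next
      case PB
      show ?thesis unfolding PB P_def party.case by measurable
    next
      case PC
      show ?thesis unfolding PC P_def party.case by measurable
    qed
    have neq: "msgs_of b d c t PA j = msgs_of b [] c t PA j" "msgs_of b d c t j PA = msgs_of b [] c t j PA"
      "msgs_of b d c t PB j = msgs_of b d [] t PB j" "msgs_of b d c t j PB = msgs_of b d [] t j PB"
      "msgs_of b d c t PC j = msgs_of [] d c t PC j" "msgs_of b d c t j PC = msgs_of [] d c t j PC" for t j
      by (cases j; simp)+
    have FP: "F (msgs_of b [] c) PA = F ?h PA" "F (msgs_of b d []) PB = F ?h PB" "F (msgs_of [] d c) PC = F ?h PC"
      by (rule ext, rule F_cong; simp add: neq)+
    have "measure_pmf.prob q {w. w12 w = b \<and> w23 w = d \<and> w31 w = c \<and> X w = x \<and> Y w = y \<and> Z w = z}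
       = prob {\<omega>\<in>space M. \<forall>i. P i (R i \<omega>)}"
    proof (rule prob_q_AE)
      show "Measurable.pred M (\<lambda>\<omega>. \<forall>i. P i (R i \<omega>))" by measurable
      show "AE \<omega> in M. (w12 (W \<omega>) = b \<and> w23 (W \<omega>) = d \<and> w31 (W \<omega>) = c \<and> X (W \<omega>) = x \<and> Y (W \<omega>) = y \<and> Z (W \<omega>) = z)
          = (\<forall>i. P i (R i \<omega>))"
        using AE_transcripts
      proof eventually_elim
        case (elim \<omega>)
        let ?m = "msg nm (\<lambda>k. R k \<omega>)"
        have all: "(\<forall>i. Q i) \<longleftrightarrow> Q PA \<and> Q PB \<and> Q PC" for Q
          by (metis party.exhaust)
        have run: "(\<forall>i. F ?h i (R i \<omega>)) \<longleftrightarrow> (\<forall>i j t. i \<noteq> j \<longrightarrow> ?m t i j = ?h t i j)"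
        proof -
          have "(\<forall>i. F ?h i (R i \<omega>)) \<longleftrightarrow> (\<forall>n. \<forall>i. follows nm ?h i n (R i \<omega>))"
            unfolding F_def by blast
          also have "\<dots> \<longleftrightarrow> (\<forall>n. \<forall>i j t. i \<noteq> j \<longrightarrow> t < n \<longrightarrow> ?m t i j = ?h t i j)"
            by (subst msgs_eq_iff_follows[of "\<lambda>_. _", symmetric]) auto
          also have "\<dots> \<longleftrightarrow> (\<forall>i j t. i \<noteq> j \<longrightarrow> ?m t i j = ?h t i j)"
            by blast
          finally show ?thesis .
        qed
        have links: "(\<forall>i j t. i \<noteq> j \<longrightarrow> ?m t i j = ?h t i j) \<longleftrightarrow> M12 R nm \<omega> = b \<and> M23 R nm \<omega> = d \<and> M31 R nm \<omega> = c"
          if "trimmed b" "trimmed c" "trimmed d"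
        proof
          assume L: "\<forall>i j t. i \<noteq> j \<longrightarrow> ?m t i j = ?h t i j"
          have "(\<lambda>t. (?m t PA PB, ?m t PB PA)) = pad b" "(\<lambda>t. (?m t PB PC, ?m t PC PB)) = pad d"
            "(\<lambda>t. (?m t PC PA, ?m t PA PC)) = pad c"
            using L by (auto simp: fun_eq_iff)
          then show "M12 R nm \<omega> = b \<and> M23 R nm \<omega> = d \<and> M31 R nm \<omega> = c"
            by (simp add: M12_def M23_def M31_def link_def trunc_pad that)
        next
          assume "M12 R nm \<omega> = b \<and> M23 R nm \<omega> = d \<and> M31 R nm \<omega> = c"
          then have "?h = H (W \<omega>)" by (auto simp: H_def)
          with elim show "\<forall>i j t. i \<noteq> j \<longrightarrow> ?m t i j = ?h t i j" by simp
        qed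
        have "(\<forall>i. P i (R i \<omega>)) \<longleftrightarrow> trimmed b \<and> trimmed c \<and> trimmed d \<and> (\<forall>i. F ?h i (R i \<omega>)) \<and>
           oA (R PA \<omega>) b c = x \<and> oB (R PB \<omega>) b d = y \<and> oC (R PC \<omega>) d c = z"
          unfolding all P_def party.case FP by blast
        then show ?case
          unfolding run proj_W outX_def outY_def outZ_def using links elim by auto
      qed
    qed
    also have "\<dots> = (\<Prod>i\<in>UNIV. prob {\<omega>\<in>space M. P i (R i \<omega>)})"
      by (rule prob_all_parties[OF P_meas])
    also have "\<dots> = \<alpha> b c x * \<beta> b d y * \<gamma> d c z"
      by (simp add: UNIV_party P_def \<alpha>_def \<beta>_def \<gamma>_def)
    finally show "measure_pmf.prob q {w. w12 w = b \<and> w23 w = d \<and> w31 w = c \<and> X w = x \<and> Y w = y \<and> Z w = z}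
      = \<alpha> b c x * \<beta> b d y * \<gamma> d c z" .
  qed
qed

text \<open>The factor of one party is set against the product of the other two. These chains come
  from the communication structure; paired with the privacy chains centred at the outputs, they feed
  \<open>determines_by_normal_form\<close>.\<close>

lemma cond_indep_outputs:
  "cond_indep q X (\<lambda>w. (w12 w, w31 w)) (\<lambda>w. (Y w, Z w))"
  "cond_indep q Y (\<lambda>w. (w12 w, w23 w)) (\<lambda>w. (X w, Z w))"
  "cond_indep q Z (\<lambda>w. (w23 w, w31 w)) (\<lambda>w. (X w, Y w))"
proof -
  obtain \<alpha> \<beta> \<gamma> where
    f: "\<And>b d c x y z. measure_pmf.prob q {w. w12 w = b \<and> w23 w = d \<and> w31 w = c \<and> X w = x \<and> Y w = y \<and> Z w = z}
      = \<alpha> b c x * \<beta> b d y * \<gamma> d c z"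
    and nn: "\<And>b c x. \<alpha> b c x \<ge> 0" "\<And>b d y. \<beta> b d y \<ge> 0" "\<And>d c z. \<gamma> d c z \<ge> (0::real)"
    by (rule prob_q_outputs) blast
  have "cond_indep q X (\<lambda>w. (w12 w, w31 w)) (\<lambda>w. (w23 w, Y w, Z w))"
  proof (rule cond_indep_factorI)
    fix x bc dyz
    show "measure_pmf.prob q {w. X w = x \<and> (w12 w, w31 w) = bc \<and> (w23 w, Y w, Z w) = dyz}
      = (\<lambda>x (b, c). \<alpha> b c x) x bc * (\<lambda>(b, c) (d, y, z). \<beta> b d y * \<gamma> d c z) bc dyz"
      using f[of "fst bc" "fst dyz" "snd bc" x "fst (snd dyz)" "snd (snd dyz)"]
      by (cases bc; cases dyz) (simp add: conj_ac mult_ac)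
  qed (auto simp: nn split: prod.split)
  then show "cond_indep q X (\<lambda>w. (w12 w, w31 w)) (\<lambda>w. (Y w, Z w))"
    by (rule cond_indep_coarsen) (auto intro: determinesI)
  have "cond_indep q Y (\<lambda>w. (w12 w, w23 w)) (\<lambda>w. (w31 w, X w, Z w))"
  proof (rule cond_indep_factorI)
    fix y bd cxz
    show "measure_pmf.prob q {w. Y w = y \<and> (w12 w, w23 w) = bd \<and> (w31 w, X w, Z w) = cxz}
      = (\<lambda>y (b, d). \<beta> b d y) y bd * (\<lambda>(b, d) (c, x, z). \<alpha> b c x * \<gamma> d c z) bd cxz"
      using f[of "fst bd" "snd bd" "fst cxz" "fst (snd cxz)" y "snd (snd cxz)"]
      by (cases bd; cases cxz) (simp add: conj_ac mult_ac)
  qed (auto simp: nn split: prod.split)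
  then show "cond_indep q Y (\<lambda>w. (w12 w, w23 w)) (\<lambda>w. (X w, Z w))"
    by (rule cond_indep_coarsen) (auto intro: determinesI)
  have "cond_indep q Z (\<lambda>w. (w23 w, w31 w)) (\<lambda>w. (w12 w, X w, Y w))"
  proof (rule cond_indep_factorI)
    fix z dc bxy
    show "measure_pmf.prob q {w. Z w = z \<and> (w23 w, w31 w) = dc \<and> (w12 w, X w, Y w) = bxy}
      = (\<lambda>z (d, c). \<gamma> d c z) z dc * (\<lambda>(d, c) (b, x, y). \<alpha> b c x * \<beta> b d y) dc bxy"
      using f[of "fst bxy" "fst dc" "snd dc" "fst (snd bxy)" "snd (snd bxy)" z]
      by (cases dc; cases bxy) (simp add: conj_ac mult_ac)
  qed (auto simp: nn split: prod.split)
  then show "cond_indep q Z (\<lambda>w. (w23 w, w31 w)) (\<lambda>w. (X w, Y w))"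
    by (rule cond_indep_coarsen) (auto intro: determinesI)
qed

end

text \<open>An infinite entropy meets every bound; a finite one makes the surprisal integrable. This
  is the source of the assumption that the bounded link has finite entropy.\<close>

lemma disc_ent_ge:
  assumes law: "\<And>a. measure M {\<omega>\<in>space M. A \<omega> = a} = measure_pmf.prob q {w. A' w = a}"
    and bound: "fin_ent q A' \<Longrightarrow> r \<le> ent q A'"
  shows "disc_ent M A \<ge> ennreal r"
proof -
  let ?g = "\<lambda>a. - log 2 (pmf (map_pmf A' q) a)"
  have p: "pmf (map_pmf A' q) a = measure_pmf.prob q {w. A' w = a}" for a
    by (simp add: pmf_map vimage_def)
  have "disc_ent M A = (\<integral>\<^sup>+a. ennreal (pmf (map_pmf A' q) a) * ennreal (?g a) \<partial>count_space UNIV)"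
    unfolding disc_ent_def law p[symmetric] by (intro nn_integral_cong) (simp add: ennreal_mult'[symmetric])
  also have "\<dots> = (\<integral>\<^sup>+a. ennreal (?g a) \<partial>measure_pmf (map_pmf A' q))"
    by (rule nn_integral_measure_pmf[symmetric])
  also have "\<dots> = (\<integral>\<^sup>+w. ennreal (surprisal q A' w) \<partial>measure_pmf q)"
    by (simp add: surprisal_def pr_def p)
  finally have d: "disc_ent M A = (\<integral>\<^sup>+w. ennreal (surprisal q A' w) \<partial>measure_pmf q)" .
  have nn: "AE w in measure_pmf q. 0 \<le> surprisal q A' w"
    by (rule AE_pmfI) (rule surprisal_nonneg)
  show ?thesis
  proof (cases "disc_ent M A = \<infinity>")
    case False
    then have i: "integrable (measure_pmf q) (surprisal q A')"
      using d nn by (intro integrableI_nonneg) (auto simp: less_top)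
    have "ent q A' = (\<integral>w. surprisal q A' w \<partial>measure_pmf q)"
      unfolding cond_ent_def surprisal_const diff_0_right
      by (intro integral_cong_AE AE_pmfI surprisal_cong) (auto simp: determines_def)
    then have "disc_ent M A = ennreal (ent q A')"
      unfolding d using nn_integral_eq_integral[OF i nn] by simp
    then show ?thesis
      using bound i by (simp add: fin_ent_def ennreal_leI)
  qed simp
qed

section \<open>From finitely many rounds to the three entropy bounds\<close>

context protocol_run
begin

lemma cond_indep_of_markov_chain:
  assumes "markov_chain M (\<lambda>\<omega>. f (W \<omega>)) (\<lambda>\<omega>. g (W \<omega>)) (\<lambda>\<omega>. h (W \<omega>))"
  shows "cond_indep q f g h"
  using assms unfolding cond_indep_def markov_chain_def prob_q .

text \<open>The limit of \<open>lnk\<close> as the clocks grow, in the same type; on the support it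
  carries the information of the recorded list.\<close>

definition full_lnk where
  "full_lnk i j w = (\<lambda>t a b. if a = i \<and> b = j \<or> a = j \<and> b = i then H w t a b else None)"

text \<open>A recorded transcript is a finite list, so a link is complete once T reaches its length.
  That time depends on the outcome and need not be bounded.\<close>

lemma eventually_lnk: "\<forall>\<^sub>F T in sequentially. lnk H (\<lambda>_. T) i j w = full_lnk i j w"
proof -
  let ?N = "length (w12 w) + length (w23 w) + length (w31 w)"
  have "H w t a b = None" if "t \<ge> ?N" for t a b
    using that by (cases a; cases b) (auto simp: H_def pad_def)
  then have "lnk H (\<lambda>_. T) i j w = full_lnk i j w" if "T \<ge> ?N" for T
    using that by (auto simp: lnk_def full_lnk_def fun_eq_iff not_less)
  then show ?thesis
    by (auto simp: eventually_sequentially)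
qed

lemma determines_lnk:
  "determines q w12 (lnk H n PA PB)" "determines q w23 (lnk H n PB PC)" "determines q w31 (lnk H n PC PA)"
  by (rule determinesI; simp add: lnk_eq_iff H_def)+

lemma full_lnk_determines:
  "determines q (full_lnk PA PB) w12" "determines q (full_lnk PB PC) w23" "determines q (full_lnk PC PA) w31"
proof -
  have e: "H v t i j = H w t i j \<and> H v t j i = H w t j i" if "full_lnk i j v = full_lnk i j w" for v w t i j
    using fun_cong[OF fun_cong[OF fun_cong[OF that, of t], of i], of j]
      fun_cong[OF fun_cong[OF fun_cong[OF that, of t], of j], of i]
    by (simp add: full_lnk_def)
  have tr: "l = l'" if "trimmed l" "trimmed l'" "\<And>t. pad l t = pad l' t" for l l' :: "('m option \<times> 'm option) list"
  proof -
    have "pad l = pad l'" using that(3) by (rule ext)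
    then show ?thesis using trunc_pad[OF that(1)] trunc_pad[OF that(2)] by metis
  qed
  show "determines q (full_lnk PA PB) w12"
  proof (rule determinesI)
    fix v w assume *: "v \<in> set_pmf q" "w \<in> set_pmf q" "full_lnk PA PB v = full_lnk PA PB w"
    show "w12 v = w12 w"
      using e[OF *(3)] by (intro tr trimmed_supp * prod_eqI) (simp_all add: H_def)
  qed
  show "determines q (full_lnk PB PC) w23"
  proof (rule determinesI)
    fix v w assume *: "v \<in> set_pmf q" "w \<in> set_pmf q" "full_lnk PB PC v = full_lnk PB PC w"
    show "w23 v = w23 w"
      using e[OF *(3)] by (intro tr trimmed_supp * prod_eqI) (simp_all add: H_def)
  qed
  show "determines q (full_lnk PC PA) w31"
  proof (rule determinesI)
    fix v w assume *: "v \<in> set_pmf q" "w \<in> set_pmf q" "full_lnk PC PA v = full_lnk PC PA w"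
    show "w31 v = w31 w"
      using e[OF *(3)] by (intro tr trimmed_supp * prod_eqI) (simp_all add: H_def)
  qed
qed

lemma cond_ent_output_tendsto_0:
  fixes U :: "('m, 'x, 'y, 'z) outcome \<Rightarrow> 'u::finite"
  assumes "determines q (\<lambda>w. (V w, V' w)) U" "determines q (full_lnk i j) V" "determines q (full_lnk k l) V'"
  shows "(\<lambda>T. cond_ent q U (\<lambda>w. (lnk H (\<lambda>_. T) i j w, lnk H (\<lambda>_. T) k l w))) \<longlonglongrightarrow> 0"
proof (rule cond_ent_tendsto_0)
  fix w
  show "\<forall>\<^sub>F T in sequentially. (lnk H (\<lambda>_. T) i j w, lnk H (\<lambda>_. T) k l w) = (full_lnk i j w, full_lnk k l w)"
    using eventually_lnk[of i j w] eventually_lnk[of k l w] by eventually_elim simp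
next
  show "determines q (\<lambda>w. (full_lnk i j w, full_lnk k l w)) U"
    by (rule determinesI, rule determinesD[OF assms(1)]) (auto intro: determinesD[OF assms(2)] determinesD[OF assms(3)])
qed

text \<open>The parties are labelled by an arbitrary permutation, with i opposite to the bounded
  link, so that the three bounds are instances of one statement.\<close>

lemma entropy_bound:
  fixes U :: "('m, 'x, 'y, 'z) outcome \<Rightarrow> 'u::finite" and V :: "('m, 'x, 'y, 'z) outcome \<Rightarrow> 'v::finite"
    and V' :: "('m, 'x, 'y, 'z) outcome \<Rightarrow> 't::finite"
  assumes ijk: "UNIV = {i, j, k}" "i \<noteq> j" "i \<noteq> k" "j \<noteq> k"
    and l: "\<And>n. determines q lij (lnk H n i j)" "\<And>n. determines q lik (lnk H n i k)" "\<And>n. determines q ljk (lnk H n j k)"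
    and f: "determines q (full_lnk i j) lij" "determines q (full_lnk i k) lik" "determines q (full_lnk j k) ljk"
    and det: "determines q (\<lambda>w. (lij w, lik w)) U" "determines q (\<lambda>w. (lij w, ljk w)) V" "determines q (\<lambda>w. (lik w, ljk w)) V'"
    and sec: "cond_indep q (\<lambda>w. (lij w, lik w)) U (\<lambda>w. (V w, V' w))"
      "cond_indep q (\<lambda>w. (lij w, ljk w)) V (\<lambda>w. (U w, V' w))"
      "cond_indep q (\<lambda>w. (lik w, ljk w)) V' (\<lambda>w. (U w, V w))"
    and fin: "fin_ent q ljk"
  shows "resid_info (map_pmf (\<lambda>w. (U w, V' w)) q) + resid_info (map_pmf (\<lambda>w. (U w, V w)) q)
      + (ent q (\<lambda>w. (U w, V w, V' w)) - ent q U) \<le> ent q ljk"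
proof (rule entropy_bound_of_approximations[where B="\<lambda>T. lnk H (\<lambda>_. T) i j" and C="\<lambda>T. lnk H (\<lambda>_. T) i k"
      and D="\<lambda>T. lnk H (\<lambda>_. T) j k"])
  show "coinfo_nonneg q (lnk H (\<lambda>_. T) i j) (lnk H (\<lambda>_. T) i k) (lnk H (\<lambda>_. T) j k)" for T
    by (rule coinfo_nonneg_lnk[OF ijk fin_ent_mono[OF fin l(3)]])
  show "cond_indep q (\<lambda>w. (lnk H (\<lambda>_. T) i j w, lnk H (\<lambda>_. T) i k w)) U (\<lambda>w. (V w, V' w))" for T
    by (rule cond_indep_coarsen_left[OF sec(1)], rule determinesI) (auto intro: determinesD[OF l(1)] determinesD[OF l(2)])
  show "cond_indep q (\<lambda>w. (lnk H (\<lambda>_. T) i j w, lnk H (\<lambda>_. T) j k w)) V (\<lambda>w. (U w, V' w))" for T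
    by (rule cond_indep_coarsen_left[OF sec(2)], rule determinesI) (auto intro: determinesD[OF l(1)] determinesD[OF l(3)])
  show "cond_indep q (\<lambda>w. (lnk H (\<lambda>_. T) i k w, lnk H (\<lambda>_. T) j k w)) V' (\<lambda>w. (U w, V w))" for T
    by (rule cond_indep_coarsen_left[OF sec(3)], rule determinesI) (auto intro: determinesD[OF l(2)] determinesD[OF l(3)])
qed (rule fin l cond_ent_output_tendsto_0[OF det(1) f(1,2)] cond_ent_output_tendsto_0[OF det(2) f(1,3)]
      cond_ent_output_tendsto_0[OF det(3) f(2,3)])+

lemma secure_bounds:
  assumes nf: "normal_form p"
    and law: "\<And>x y z. prob {\<omega>\<in>space M. outX R nm oA \<omega> = x \<and> outY R nm oB \<omega> = y \<and> outZ R nm oC \<omega> = z} = pmf p (x, y, z)"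
    and secX: "markov_chain M (\<lambda>\<omega>. (M12 R nm \<omega>, M31 R nm \<omega>)) (outX R nm oA) (\<lambda>\<omega>. (outY R nm oB \<omega>, outZ R nm oC \<omega>))"
    and secY: "markov_chain M (\<lambda>\<omega>. (M12 R nm \<omega>, M23 R nm \<omega>)) (outY R nm oB) (\<lambda>\<omega>. (outX R nm oA \<omega>, outZ R nm oC \<omega>))"
    and secZ: "markov_chain M (\<lambda>\<omega>. (M23 R nm \<omega>, M31 R nm \<omega>)) (outZ R nm oC) (\<lambda>\<omega>. (outX R nm oA \<omega>, outY R nm oB \<omega>))"
  shows "disc_ent M (M23 R nm) \<ge> ennreal (
           resid_info (map_pmf (\<lambda>(x,y,z). (x,z)) p) + resid_info (map_pmf (\<lambda>(x,y,z). (x,y)) p)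
           + (pmf_ent p - pmf_ent (map_pmf (\<lambda>(x,y,z). x) p)))" (is ?A)
    and "disc_ent M (M31 R nm) \<ge> ennreal (
           resid_info (map_pmf (\<lambda>(x,y,z). (y,z)) p) + resid_info (map_pmf (\<lambda>(x,y,z). (x,y)) p)
           + (pmf_ent p - pmf_ent (map_pmf (\<lambda>(x,y,z). y) p)))" (is ?B)
    and "disc_ent M (M12 R nm) \<ge> ennreal (
           resid_info (map_pmf (\<lambda>(x,y,z). (x,z)) p) + resid_info (map_pmf (\<lambda>(x,y,z). (y,z)) p)
           + (pmf_ent p - pmf_ent (map_pmf (\<lambda>(x,y,z). z) p)))" (is ?C)
proof -
  have pq: "p = map_pmf (\<lambda>w. (X w, Y w, Z w)) q"
  proof (rule pmf_eqI)
    fix a :: "'x \<times> 'y \<times> 'z"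
    obtain x y z where a: "a = (x, y, z)" by (cases a)
    show "pmf p a = pmf (map_pmf (\<lambda>w. (X w, Y w, Z w)) q) a"
      by (simp add: a pmf_map vimage_def prob_q law)
  qed
  have P: "measure_pmf.prob q {w. X w = x \<and> Y w = y \<and> Z w = z} = pmf p (x, y, z)" for x y z
    by (simp add: prob_q law)
  have sX: "cond_indep q (\<lambda>w. (w12 w, w31 w)) X (\<lambda>w. (Y w, Z w))"
    by (rule cond_indep_of_markov_chain) (simp add: secX)
  have sY: "cond_indep q (\<lambda>w. (w12 w, w23 w)) Y (\<lambda>w. (X w, Z w))"
    by (rule cond_indep_of_markov_chain) (simp add: secY)
  have sZ: "cond_indep q (\<lambda>w. (w23 w, w31 w)) Z (\<lambda>w. (X w, Y w))"
    by (rule cond_indep_of_markov_chain) (simp add: secZ)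
  have dX: "determines q (\<lambda>w. (w12 w, w31 w)) X"
  proof (rule determines_by_normal_form[OF cond_indep_outputs(1) sX])
    fix x x' c assume c: "c \<ge> (0::real)" and e: "\<And>yz. measure_pmf.prob q {w. X w = x \<and> (Y w, Z w) = yz}
        = c * measure_pmf.prob q {w. X w = x' \<and> (Y w, Z w) = yz}"
    have "pmf p (x, y, z) = c * pmf p (x', y, z)" for y z
      using e[of "(y, z)"] P[of x y z] P[of x' y z] by simp
    with c show "x = x'"
      by (intro nf[unfolded normal_form_def, THEN conjunct1, rule_format]) auto
  qed
  have dY: "determines q (\<lambda>w. (w12 w, w23 w)) Y"
  proof (rule determines_by_normal_form[OF cond_indep_outputs(2) sY])
    fix y y' c assume c: "c \<ge> (0::real)" and e: "\<And>xz. measure_pmf.prob q {w. Y w = y \<and> (X w, Z w) = xz}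
        = c * measure_pmf.prob q {w. Y w = y' \<and> (X w, Z w) = xz}"
    have "pmf p (x, y, z) = c * pmf p (x, y', z)" for x z
      using e[of "(x, z)"] P[of x y z] P[of x y' z] by (simp add: conj_ac)
    with c show "y = y'"
      by (intro nf[unfolded normal_form_def, THEN conjunct2, THEN conjunct1, rule_format]) auto
  qed
  have dZ: "determines q (\<lambda>w. (w23 w, w31 w)) Z"
  proof (rule determines_by_normal_form[OF cond_indep_outputs(3) sZ])
    fix z z' c assume c: "c \<ge> (0::real)" and e: "\<And>xy. measure_pmf.prob q {w. Z w = z \<and> (X w, Y w) = xy}
        = c * measure_pmf.prob q {w. Z w = z' \<and> (X w, Y w) = xy}"
    have "pmf p (x, y, z) = c * pmf p (x, y, z')" for x y
      using e[of "(x, y)"] P[of x y z] P[of x y z'] by (simp add: conj_ac)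
    with c show "z = z'"
      by (intro nf[unfolded normal_form_def, THEN conjunct2, THEN conjunct2, rule_format]) auto
  qed
  have ent_p: "pmf_ent p = ent q (\<lambda>w. (X w, Y w, Z w))"
    "pmf_ent (map_pmf (\<lambda>(x,y,z). x) p) = ent q X" "pmf_ent (map_pmf (\<lambda>(x,y,z). y) p) = ent q Y"
    "pmf_ent (map_pmf (\<lambda>(x,y,z). z) p) = ent q Z"
    unfolding pq by (simp_all add: pmf.map_comp o_def pmf_ent_map_pmf)
  have map_p: "map_pmf (\<lambda>(x,y,z). (x,y)) p = map_pmf (\<lambda>w. (X w, Y w)) q"
    "map_pmf (\<lambda>(x,y,z). (x,z)) p = map_pmf (\<lambda>w. (X w, Z w)) q"
    "map_pmf (\<lambda>(x,y,z). (y,z)) p = map_pmf (\<lambda>w. (Y w, Z w)) q"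
    unfolding pq by (simp_all add: pmf.map_comp o_def)
  have sw: "resid_info (map_pmf (\<lambda>w. (U w, V w)) q) = resid_info (map_pmf (\<lambda>w. (V w, U w)) q)"
    for U :: "('m, 'x, 'y, 'z) outcome \<Rightarrow> 'u" and V :: "('m, 'x, 'y, 'z) outcome \<Rightarrow> 'v"
    using resid_info_swap[of "map_pmf (\<lambda>w. (V w, U w)) q"] by (simp add: pmf.map_comp o_def)
  have swd: "determines q (\<lambda>w. (U w, V w)) A" if "determines q (\<lambda>w. (V w, U w)) A"
    for U :: "('m, 'x, 'y, 'z) outcome \<Rightarrow> 'u" and V :: "('m, 'x, 'y, 'z) outcome \<Rightarrow> 'v" and A :: "('m, 'x, 'y, 'z) outcome \<Rightarrow> 'a"
    by (rule determinesI) (auto intro: determinesD[OF that])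
  have swi: "cond_indep q (\<lambda>w. (U w, V w)) A (\<lambda>w. (B w, C w))"
    if "cond_indep q (\<lambda>w. (V w, U w)) A (\<lambda>w. (C w, B w)) \<or> cond_indep q (\<lambda>w. (U w, V w)) A (\<lambda>w. (C w, B w))
      \<or> cond_indep q (\<lambda>w. (V w, U w)) A (\<lambda>w. (B w, C w))"
    for U :: "('m, 'x, 'y, 'z) outcome \<Rightarrow> 'u" and V :: "('m, 'x, 'y, 'z) outcome \<Rightarrow> 'v" and A :: "('m, 'x, 'y, 'z) outcome \<Rightarrow> 'a"
      and B :: "('m, 'x, 'y, 'z) outcome \<Rightarrow> 'b" and C :: "('m, 'x, 'y, 'z) outcome \<Rightarrow> 'c"
    using that by (elim disjE) (erule cond_indep_coarsen, auto intro!: determinesI)+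
  have flc: "full_lnk i j = full_lnk j i" for i j
    by (auto simp: full_lnk_def fun_eq_iff)
  note d = determines_lnk and f = full_lnk_determines
  \<comment> \<open>The instances below name a link from either end, so each fact is also supplied
    with its ends exchanged.\<close>
  note d' = d[unfolded lnk_commute[of H _ PC PA]] d[unfolded lnk_commute[of H _ PB PC]] d[unfolded lnk_commute[of H _ PA PB]]
  note f' = f[unfolded flc[of PC PA]] f[unfolded flc[of PB PC]] f[unfolded flc[of PA PB]]
  have cX: "ent q (\<lambda>w. (Y w, X w, Z w)) = ent q (\<lambda>w. (X w, Y w, Z w))"
    "ent q (\<lambda>w. (Z w, X w, Y w)) = ent q (\<lambda>w. (X w, Y w, Z w))"
    by (rule cond_ent_cong; auto intro: determinesI)+
  show ?A
  proof (rule disc_ent_ge[where q=q and A'=w23])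
    show "measure M {\<omega>\<in>space M. M23 R nm \<omega> = a} = measure_pmf.prob q {w. w23 w = a}" for a
      by (simp add: prob_q)
    assume fin: "fin_ent q w23"
    show "resid_info (map_pmf (\<lambda>(x,y,z). (x,z)) p) + resid_info (map_pmf (\<lambda>(x,y,z). (x,y)) p)
           + (pmf_ent p - pmf_ent (map_pmf (\<lambda>(x,y,z). x) p)) \<le> ent q w23"
      unfolding ent_p map_p
      by (rule entropy_bound[of PA PB PC w12 w31 w23])
        (auto simp: UNIV_party intro: d d' f f' dX dY dZ swd sX sY sZ swi fin)
  qed
  show ?B
  proof (rule disc_ent_ge[where q=q and A'=w31])
    show "measure M {\<omega>\<in>space M. M31 R nm \<omega> = a} = measure_pmf.prob q {w. w31 w = a}" for a
      by (simp add: prob_q)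
    assume fin: "fin_ent q w31"
    show "resid_info (map_pmf (\<lambda>(x,y,z). (y,z)) p) + resid_info (map_pmf (\<lambda>(x,y,z). (x,y)) p)
           + (pmf_ent p - pmf_ent (map_pmf (\<lambda>(x,y,z). y) p)) \<le> ent q w31"
      unfolding ent_p map_p sw[of X Y] cX(1)[symmetric]
      by (rule entropy_bound[of PB PA PC w12 w23 w31])
        (auto simp: UNIV_party intro: d d' f f' dX dY dZ swd sX sY sZ swi fin)
  qed
  show ?C
  proof (rule disc_ent_ge[where q=q and A'=w12])
    show "measure M {\<omega>\<in>space M. M12 R nm \<omega> = a} = measure_pmf.prob q {w. w12 w = a}" for a
      by (simp add: prob_q)
    assume fin: "fin_ent q w12"
    have "resid_info (map_pmf (\<lambda>w. (Z w, Y w)) q) + resid_info (map_pmf (\<lambda>w. (Z w, X w)) q)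
           + (ent q (\<lambda>w. (Z w, X w, Y w)) - ent q Z) \<le> ent q w12"
      by (rule entropy_bound[of PC PA PB w31 w23 w12])
        (auto simp: UNIV_party intro: d d' f f' dX dY dZ swd sX sY sZ swi fin)
    then show "resid_info (map_pmf (\<lambda>(x,y,z). (x,z)) p) + resid_info (map_pmf (\<lambda>(x,y,z). (y,z)) p)
           + (pmf_ent p - pmf_ent (map_pmf (\<lambda>(x,y,z). z) p)) \<le> ent q w12"
      unfolding ent_p map_p sw[of X Z] sw[of Y Z] cX(2)[symmetric] by linarith
  qed
qed

end

theorem theorem9:
  fixes p :: "('x::finite \<times> 'y::finite \<times> 'z::finite) pmf"
    and M :: "'w measure" and S :: "party \<Rightarrow> 'r measure" and R :: "party \<Rightarrow> 'w \<Rightarrow> 'r"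
    and nm :: "party \<Rightarrow> party \<Rightarrow> nat \<Rightarrow> 'r \<Rightarrow> (party \<Rightarrow> 'm::countable option) list \<Rightarrow> 'm option"
    and oA :: "'r \<Rightarrow> ('m option \<times> 'm option) list \<Rightarrow> ('m option \<times> 'm option) list \<Rightarrow> 'x"
    and oB :: "'r \<Rightarrow> ('m option \<times> 'm option) list \<Rightarrow> ('m option \<times> 'm option) list \<Rightarrow> 'y"
    and oC :: "'r \<Rightarrow> ('m option \<times> 'm option) list \<Rightarrow> ('m option \<times> 'm option) list \<Rightarrow> 'z"
  assumes "normal_form p"
    and "secure_sampling p M S R nm oA oB oC"
  shows "(disc_ent M (M23 R nm) \<ge> ennreal (
           resid_info (map_pmf (\<lambda>(x,y,z). (x,z)) p) + resid_info (map_pmf (\<lambda>(x,y,z). (x,y)) p)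
           + (pmf_ent p - pmf_ent (map_pmf (\<lambda>(x,y,z). x) p)))) \<and>
          (disc_ent M (M31 R nm) \<ge> ennreal (
           resid_info (map_pmf (\<lambda>(x,y,z). (y,z)) p) + resid_info (map_pmf (\<lambda>(x,y,z). (x,y)) p)
           + (pmf_ent p - pmf_ent (map_pmf (\<lambda>(x,y,z). y) p)))) \<and>
          (disc_ent M (M12 R nm) \<ge> ennreal (
           resid_info (map_pmf (\<lambda>(x,y,z). (x,z)) p) + resid_info (map_pmf (\<lambda>(x,y,z). (y,z)) p)
           + (pmf_ent p - pmf_ent (map_pmf (\<lambda>(x,y,z). z) p))))"
proof -
  have pr: "protocol M S R nm oA oB oC"
    using assms(2) by (simp add: secure_sampling_def)
  interpret prob_space M
    using pr by (simp add: protocol_def)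
  interpret protocol_run M S R nm oA oB oC
    using pr by unfold_locales (simp_all add: protocol_def)
  show ?thesis
    using assms(2) by (intro conjI secure_bounds assms(1)) (simp_all add: secure_sampling_def Let_def)
qed

end
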